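(* Let $X$ be a compact metric space, let $K\colon X\times X\to\mathbb{F}$ be a Mercer kernel on $X$, let $\nu$ be a finite Borel measure on $X$ such that $\operatorname{supp}(\nu)\supseteq \operatorname{supp}(K)$, and let $L_K$ be the integral operator on $L^2_{\mathbb F}(X,\nu)$ with symbol $K$. Let $\lambda_1\geq\lambda_2\geq\cdots>0$ be all the nonzero eigenvalues of $L_K$, counted with their multiplicities, and let $\{\phi_n\}_n$ be an orthonormal system in $L^2_{\mathbb F}(X,\nu)$ of corresponding eigenfunctions, $L_K\phi_n=\lambda_n\phi_n$, where each $\phi_n$ is taken as the continuous function $\phi_n(x)=\frac{1}{\lambda_n}\int_X K(x,t)\phi_n(t)\,d\nu(t)$, $x\in X$. Then $$K(x,y)=\sum_{n=1}^\infty \lambda_n\phi_n(x)\overline{\phi_n(y)},\quad x,y\in X,$$ where the series converges absolutely and uniformly on $X\times X$.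
   Context: $\mathbb F$ is either $\mathbb R$ or $\mathbb C$. A kernel $K\colon X\times X\to\mathbb F$ is Hermitian/symmetric if $K(y,x)=\overline{K(x,y)}$ for all $x,y\in X$, and positive semidefinite if $\sum_{i,j=1}^n\overline{\alpha_i}\alpha_jK(x_i,x_j)\geq0$ for all $n\in\mathbb N$, $x_1,\dots,x_n\in X$, $\alpha_1,\dots,\alpha_n\in\mathbb F$. A Mercer kernel on a compact metric space $X$ is a kernel that is continuous, Hermitian/symmetric and positive semidefinite. $\operatorname{supp}(K)$ is the set of all $x\in X$ for which there exists $y\in X$ with $K(x,y)\neq0$ or $K(y,x)\neq0$ (no closure is taken). $\operatorname{supp}(\nu)=\{x\in X\mid \nu(V)\neq0\text{ for all open neighbourhoods }V\text{ of }x\}$. The integral operator $L_K\colon L^2_{\mathbb F}(X,\nu)\to L^2_{\mathbb F}(X,\nu)$ with symbol $K$ is $(L_Kf)(x)=\int_XK(x,t)f(t)\,d\nu(t)$. It is a positive Hilbert-Schmidt (hence compact) operator whose values have continuous representatives given by this formula for every $x\in X$. If $L_K$ has only finitely many nonzero eigenvalues (counted with multiplicity), the series is the corresponding finite sum. *)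

theory Defs
  imports "HOL-Analysis.Analysis" "HOL-Library.Extended_Nat"
begin

section \<open>The scalar field\<close>

text \<open>
  The scalars are the reals or the complex numbers; \<open>conjg\<close> is the conjugation
  (the identity on the reals). The lemma \<open>real_or_complex\<close> below shows that the
  axioms admit no other fields. The superclass \<open>euclidean_space\<close> supplies what
  the Bochner integral asks of its codomain.
\<close>

class real_or_complex = real_normed_field + euclidean_space +
  fixes conjg :: "'a \<Rightarrow> 'a"
  assumes conjg_add: "conjg (x + y) = conjg x + conjg y"
    and mult_conjg_scaleR: "x * conjg x = (norm x)\<^sup>2 *\<^sub>R 1"

instantiation real :: real_or_complex
begin

definition conjg_real :: "real \<Rightarrow> real" where "conjg_real x = x"

instance
  by standard (simp_all add: conjg_real_def power2_eq_square)

end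

instantiation complex :: real_or_complex
begin

definition conjg_complex :: "complex \<Rightarrow> complex" where "conjg_complex = cnj"

instance
  by standard (simp_all add: conjg_complex_def complex_norm_square[symmetric] scaleR_conv_of_real)

end

lemma mult_conjg: "x * conjg x = of_real ((norm x)\<^sup>2)" for x :: "'k::real_or_complex"
  by (simp add: mult_conjg_scaleR of_real_def)

lemma conjg_of_real: "conjg (of_real r :: 'k::real_or_complex) = of_real r"
proof (cases "r = 0")
  case True
  have "conjg (0::'k) = conjg 0 + conjg 0"
    using conjg_add[of "0::'k" 0] by simp
  then show ?thesis using True by simp
next
  case False
  have "of_real r * conjg (of_real r :: 'k) = of_real r * of_real r"
    by (subst mult_conjg) (simp add: power2_eq_square)
  then show ?thesis using False by simp
qed

lemma add_conjg_Reals: "x + conjg x \<in> \<real>" for x :: "'k::real_or_complex"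
proof -
  have one: "conjg (1::'k) = 1" using conjg_of_real[of 1, where 'k = 'k] by simp
  have "(x + 1) * conjg (x + 1) = x * conjg x + (x + conjg x) + 1"
    unfolding conjg_add one by (simp add: distrib_left distrib_right)
  then have "x + conjg x = of_real ((norm (x + 1))\<^sup>2) - of_real ((norm x)\<^sup>2) - 1"
    unfolding mult_conjg by simp
  then show ?thesis by (simp del: of_real_power)
qed

lemma real_or_complex:
  "(UNIV :: 'k::real_or_complex set) = \<real> \<or>
   (\<exists>i::'k. i * i = -1 \<and> (\<forall>x::'k. \<exists>a b. x = of_real a + of_real b * i))"
proof -
  have im: "\<exists>a w. x = of_real a + w \<and> conjg w = - w" for x :: 'k
  proof -
    obtain r where r: "x + conjg x = of_real r"
      using add_conjg_Reals[of x] by (auto elim: Reals_cases)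
    have c: "conjg x = of_real r - x" using r by (metis add_diff_cancel_left')
    have "conjg (x + of_real (-r/2)) = conjg x + of_real (-r/2)"
      by (simp only: conjg_add conjg_of_real)
    then have "conjg (x + of_real (-r/2)) = - (x + of_real (-r/2))"
      unfolding c using of_real_add[of "r/2" "r/2", where 'a = 'k] by simp
    then show ?thesis
      by (intro exI[of _ "r/2"] exI[of _ "x + of_real (-r/2)"]) simp
  qed
  show ?thesis
  proof (cases "\<exists>w::'k. w \<noteq> 0 \<and> conjg w = - w")
    case False
    have "x \<in> \<real>" for x :: 'k
    proof -
      obtain a w where "x = of_real a + w" "conjg w = - w" using im by blast
      moreover have "w = 0" using False calculation(2) by blast
      ultimately show ?thesis by simp
    qed
    then show ?thesis by blast
  next
    case True
    then obtain w :: 'k where w: "w \<noteq> 0" "conjg w = - w" by blast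
    have sq: "v * v = - of_real ((norm v)\<^sup>2)" if "conjg v = - v" for v :: 'k
    proof -
      have "- (v * v) = of_real ((norm v)\<^sup>2)" using mult_conjg[of v] that by simp
      then show ?thesis by (rule minus_equation_iff[THEN iffD1, symmetric])
    qed
    define i where "i = w / of_real (norm w)"
    have nw: "of_real (norm w) \<noteq> (0::'k)" using w by simp
    have ii: "i * i = -1"
    proof -
      have "i * i = (w * w) / of_real ((norm w)\<^sup>2)"
        by (simp add: i_def power2_eq_square)
      also have "\<dots> = -1" unfolding sq[OF w(2)] using nw by simp
      finally show ?thesis .
    qed
    have "\<exists>a b. x = of_real a + of_real b * i" for x :: 'k
    proof -
      obtain a v where v: "x = of_real a + v" "conjg v = - v" using im by blast
      have "v * v = (of_real (norm v) * i) * (of_real (norm v) * i)"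
      proof -
        have "(of_real (norm v) * i) * (of_real (norm v) * i)
            = of_real ((norm v)\<^sup>2) * (i * i)"
          by (simp add: power2_eq_square mult_ac)
        then show ?thesis unfolding ii sq[OF v(2)] by simp
      qed
      then have "v = of_real (norm v) * i \<or> v = of_real (- norm v) * i"
        unfolding square_eq_iff by simp
      then obtain b where "v = of_real b * i" by blast
      then show ?thesis using v(1) by (intro exI[of _ a] exI[of _ b]) (simp only:)
    qed
    then show ?thesis using ii by blast
  qed
qed


section \<open>Mercer kernels and supports\<close>

definition hermitian_kernel :: "'a set \<Rightarrow> ('a \<Rightarrow> 'a \<Rightarrow> 'k::real_or_complex) \<Rightarrow> bool" where
  "hermitian_kernel X K \<longleftrightarrow> (\<forall>x\<in>X. \<forall>y\<in>X. K y x = conjg (K x y))"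

definition psd_kernel :: "'a set \<Rightarrow> ('a \<Rightarrow> 'a \<Rightarrow> 'k::real_or_complex) \<Rightarrow> bool" where
  "psd_kernel X K \<longleftrightarrow>
    (\<forall>(n::nat) (x::nat \<Rightarrow> 'a) (\<alpha>::nat \<Rightarrow> 'k). (\<forall>i<n. x i \<in> X) \<longrightarrow>
       (\<Sum>i<n. \<Sum>j<n. conjg (\<alpha> i) * \<alpha> j * K (x i) (x j)) \<in> \<real>\<^sub>\<ge>\<^sub>0)"

definition mercer_kernel ::
  "'a::metric_space set \<Rightarrow> ('a \<Rightarrow> 'a \<Rightarrow> 'k::real_or_complex) \<Rightarrow> bool" where
  "mercer_kernel X K \<longleftrightarrow>
     continuous_on (X \<times> X) (\<lambda>(x, y). K x y) \<and> hermitian_kernel X K \<and> psd_kernel X K"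

definition kernel_supp :: "'a set \<Rightarrow> ('a \<Rightarrow> 'a \<Rightarrow> 'k::zero) \<Rightarrow> 'a set" where
  "kernel_supp X K = {x \<in> X. \<exists>y\<in>X. K x y \<noteq> 0 \<or> K y x \<noteq> 0}"

definition measure_supp :: "'a::topological_space set \<Rightarrow> 'a measure \<Rightarrow> 'a set" where
  "measure_supp X \<nu> =
     {x \<in> X. \<forall>V. openin (top_of_set X) V \<and> x \<in> V \<longrightarrow> emeasure \<nu> V \<noteq> 0}"


section \<open>Square-integrable functions and the integral operator\<close>

text \<open>
  Elements of \<open>L\<^sup>2\<close> are handled through representatives: equations between
  them are required almost everywhere.
\<close>

definition L2_fun :: "'a measure \<Rightarrow> ('a \<Rightarrow> 'k::real_or_complex) set" where
  "L2_fun \<nu> = {f \<in> borel_measurable \<nu>. integrable \<nu> (\<lambda>x. (norm (f x))\<^sup>2)}"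

definition L2_inner ::
  "'a measure \<Rightarrow> ('a \<Rightarrow> 'k) \<Rightarrow> ('a \<Rightarrow> 'k) \<Rightarrow> 'k::real_or_complex" where
  "L2_inner \<nu> f g = (\<integral>x. f x * conjg (g x) \<partial>\<nu>)"

definition orthonormal_system ::
  "'a measure \<Rightarrow> nat set \<Rightarrow> (nat \<Rightarrow> 'a \<Rightarrow> 'k::real_or_complex) \<Rightarrow> bool" where
  "orthonormal_system \<nu> I \<phi> \<longleftrightarrow>
     (\<forall>n\<in>I. \<phi> n \<in> L2_fun \<nu>) \<and>
     (\<forall>m\<in>I. \<forall>n\<in>I. L2_inner \<nu> (\<phi> m) (\<phi> n) = (if m = n then 1 else 0))"

definition integral_op ::
  "'a measure \<Rightarrow> ('a \<Rightarrow> 'a \<Rightarrow> 'k) \<Rightarrow> ('a \<Rightarrow> 'k) \<Rightarrow> 'a \<Rightarrow> 'k::real_or_complex" where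
  "integral_op \<nu> K f x = (\<integral>t. K x t * f t \<partial>\<nu>)"

definition eigenspace ::
  "'a measure \<Rightarrow> ('a \<Rightarrow> 'a \<Rightarrow> 'k) \<Rightarrow> 'k \<Rightarrow> ('a \<Rightarrow> 'k::real_or_complex) set" where
  "eigenspace \<nu> K c = {f \<in> L2_fun \<nu>. AE x in \<nu>. integral_op \<nu> K f x = c * f x}"

definition L2_independent ::
  "'a measure \<Rightarrow> nat \<Rightarrow> (nat \<Rightarrow> 'a \<Rightarrow> 'k::real_or_complex) \<Rightarrow> bool" where
  "L2_independent \<nu> m f \<longleftrightarrow>
     (\<forall>a::nat \<Rightarrow> 'k. (AE x in \<nu>. (\<Sum>i<m. a i * f i x) = 0) \<longrightarrow> (\<forall>i<m. a i = 0))"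

text \<open>
  The multiplicity of \<open>c\<close> is the dimension, in \<open>L\<^sup>2\<close>, of its eigenspace; it is 0
  if \<open>c\<close> is not an eigenvalue.
\<close>

definition eigen_multiplicity ::
  "'a measure \<Rightarrow> ('a \<Rightarrow> 'a \<Rightarrow> 'k) \<Rightarrow> 'k::real_or_complex \<Rightarrow> enat" where
  "eigen_multiplicity \<nu> K c =
     Sup {enat m | m. \<exists>f. (\<forall>i<m. f i \<in> eigenspace \<nu> K c) \<and> L2_independent \<nu> m f}"

definition ecard :: "'b set \<Rightarrow> enat" where
  "ecard A = (if finite A then enat (card A) else \<infinity>)"

text \<open>
  A finite or infinite sequence of length \<open>N\<close>, indexed from 0, listing in
  nonincreasing order all nonzero eigenvalues, each as often as its multiplicity.
\<close>

definition enumerates_nonzero_eigenvalues ::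
  "'a measure \<Rightarrow> ('a \<Rightarrow> 'a \<Rightarrow> 'k::real_or_complex) \<Rightarrow> enat \<Rightarrow> (nat \<Rightarrow> real) \<Rightarrow> bool" where
  "enumerates_nonzero_eigenvalues \<nu> K N ev \<longleftrightarrow>
     (\<forall>n. enat n < N \<longrightarrow> ev n > 0) \<and>
     (\<forall>m n. m \<le> n \<and> enat n < N \<longrightarrow> ev n \<le> ev m) \<and>
     (\<forall>c::'k. c \<noteq> 0 \<longrightarrow>
        ecard {n. enat n < N \<and> of_real (ev n) = c} = eigen_multiplicity \<nu> K c)"

text \<open>Terms with \<open>n \<ge> N\<close> vanish, so that for finite \<open>N\<close> the series is a finite sum.\<close>

definition mercer_term ::
  "enat \<Rightarrow> (nat \<Rightarrow> real) \<Rightarrow> (nat \<Rightarrow> 'a \<Rightarrow> 'k) \<Rightarrow> nat \<Rightarrow> 'a \<Rightarrow> 'a \<Rightarrow> 'k::real_or_complex" where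
  "mercer_term N ev \<phi> n x y =
     (if enat n < N then of_real (ev n) * \<phi> n x * conjg (\<phi> n y) else 0)"

end

theory Submission
  imports Defs "HOL-Complex_Analysis.Great_Picard"
begin

text \<open>
  Positivity of the kernel, tested against a point mass at \<open>x\<close> minus \<open>\<Sum> conjg (\<phi>\<^sub>n x) \<phi>\<^sub>n \<nu>\<close>,
  gives Bessel's inequality \<open>\<Sum> \<lambda>\<^sub>n \<bar>\<phi>\<^sub>n x\<bar>\<^sup>2 \<le> K x x\<close>, hence absolute convergence of the series.
  Maximising \<open>\<parallel>T g\<parallel>\<close> over the unit ball of the orthogonal complement of the \<open>\<phi>\<^sub>n\<close> would produce
  a further eigenfunction if \<open>T\<close> did not vanish there, contradicting the multiplicities. So \<open>T\<close>
  annihilates the conjugate of the difference between \<open>K x\<close> and the series, which is therefore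
  zero almost everywhere, and everywhere by continuity and the support condition. Convergence on
  the diagonal is then uniform by Dini, and Cauchy-Schwarz transfers this to \<open>X \<times> X\<close>.
\<close>

section \<open>Conjugation\<close>

text \<open>Functions are representatives throughout, so the obstacle is the passage between almost
  everywhere and everywhere. \<open>T\<close> itself provides it: images under \<open>T\<close> are
  continuous and their sup norms are controlled by L^2 norms, so small L^2 errors become pointwise
  limits on \<open>X\<close>. Accordingly only images of the extremal sequence are made to converge,
  pointwise and boundedly, and dominated convergence takes the place of completeness of L^2. The
  extremal argument yields an eigenvalue \<open>M\<close> of the square of \<open>T\<close>, hence
  the candidates \<open>\<surd>M\<close> and \<open>- \<surd>M\<close> for \<open>T\<close>; the
  multiplicity hypothesis speaks about every nonzero scalar and so excludes both. Uniformity on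
  \<open>X \<times> X\<close> has to wait for the identity on the diagonal, because Dini presupposes
  the limit; for fixed \<open>x\<close>, Cauchy-Schwarz already gives continuity in
  \<open>y\<close>, which suffices to identify the sum.\<close>

lemma conjg_0 [simp]: "conjg 0 = (0::'k::real_or_complex)"
  using conjg_of_real[of 0, where 'k = 'k] by simp

lemma conjg_1 [simp]: "conjg 1 = (1::'k::real_or_complex)"
  using conjg_of_real[of 1, where 'k = 'k] by simp

lemma norm_conjg [simp]: "norm (conjg x) = norm (x::'k::real_or_complex)"
proof (cases "x = 0")
  case False
  have "norm x * norm (conjg x) = norm x * norm x"
    using arg_cong[OF mult_conjg[of x], of norm]
    by (simp add: norm_mult power2_eq_square)
  then show ?thesis using False by simp
qed simp

text \<open>Off zero the axiom on \<open>x * conjg x\<close> determines the conjugate by division;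
  multiplicativity, which is not among the class axioms, then reduces to that of the norm.\<close>

lemma conjg_eq_divide: "x \<noteq> 0 \<Longrightarrow> conjg x = of_real ((norm x)\<^sup>2) / (x::'k::real_or_complex)"
  using mult_conjg[of x] by (simp add: field_simps)

lemma conjg_mult [simp]: "conjg (x * y) = conjg x * conjg (y::'k::real_or_complex)"
  by (cases "x = 0 \<or> y = 0") (auto simp: conjg_eq_divide norm_mult power_mult_distrib)

lemma conjg_conjg [simp]: "conjg (conjg x) = (x::'k::real_or_complex)"
proof (cases "x = 0")
  case False
  have "conjg x * conjg (conjg x) = conjg x * x"
    using mult_conjg[of x] mult_conjg[of "conjg x"] by (simp add: mult.commute)
  moreover have "conjg x \<noteq> 0" using False norm_conjg[of x] by (metis norm_eq_zero)
  ultimately show ?thesis by simp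
qed simp

lemma bounded_linear_conjg: "bounded_linear (conjg :: 'k::real_or_complex \<Rightarrow> 'k)"
proof (rule bounded_linear_intro[where K = 1])
  show "conjg (r *\<^sub>R x) = r *\<^sub>R conjg x" for r and x :: 'k
    by (simp add: scaleR_conv_of_real conjg_of_real)
qed (simp_all add: conjg_add)

lemmas conjg_diff = linear_diff[OF bounded_linear.linear[OF bounded_linear_conjg]]
lemmas conjg_minus = linear_neg[OF bounded_linear.linear[OF bounded_linear_conjg]]
lemmas conjg_sum = linear_sum[OF bounded_linear.linear[OF bounded_linear_conjg]]
lemmas conjg_scaleR = linear_scale[OF bounded_linear.linear[OF bounded_linear_conjg]]
lemmas continuous_on_conjg = bounded_linear.continuous_on[OF bounded_linear_conjg]

lemma measurable_conjg [measurable]: "(conjg :: 'k::real_or_complex \<Rightarrow> 'k) \<in> borel_measurable borel"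
  by (rule borel_measurable_continuous_onI) (intro continuous_on_conjg continuous_on_id)

lemma integrable_conjg:
  "integrable M f \<Longrightarrow> integrable M (\<lambda>x. conjg (f x :: 'k::real_or_complex))"
  using integrable_bounded_linear[OF bounded_linear_conjg] .

text \<open>As \<open>conjg\<close> is its own inverse, it preserves and reflects integrability, so
  the identity also covers nonintegrable \<open>f\<close>.\<close>

lemma integral_conjg:
  "(\<integral>x. conjg (f x :: 'k::real_or_complex) \<partial>M) = conjg (\<integral>x. f x \<partial>M)"
  by (rule integral_bounded_linear'[OF bounded_linear_conjg bounded_linear_conjg]) simp

text \<open>Turns membership into an equation between continuous functions of \<open>z\<close>,
  whence closedness; it also identifies diagonal kernel values with their norms.\<close>

lemma nonneg_Reals_iff_norm: "z \<in> \<real>\<^sub>\<ge>\<^sub>0 \<longleftrightarrow> z = of_real (norm (z::'k::real_normed_field))"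
proof
  assume "z = of_real (norm z)"
  then show "z \<in> \<real>\<^sub>\<ge>\<^sub>0" by (metis nonneg_Reals_of_real_iff norm_ge_zero)
qed (auto elim: nonneg_Reals_cases)

lemma closed_nonneg_Reals: "closed (\<real>\<^sub>\<ge>\<^sub>0 :: 'k::real_normed_field set)"
proof -
  have "(\<real>\<^sub>\<ge>\<^sub>0 :: 'k set) = {z. z = of_real (norm z)}"
    using nonneg_Reals_iff_norm by blast
  then show ?thesis using closed_Collect_eq[of "\<lambda>z::'k. z" "\<lambda>z. of_real (norm z)"]
    by (simp add: continuous_intros)
qed

section \<open>Square-integrable functions\<close>

definition L2_norm_sq :: "'a measure \<Rightarrow> ('a \<Rightarrow> 'k::real_or_complex) \<Rightarrow> real" where
  "L2_norm_sq M f = (\<integral>x. (norm (f x))\<^sup>2 \<partial>M)"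

lemma L2_fun_measurable: "f \<in> L2_fun M \<Longrightarrow> f \<in> borel_measurable M"
  by (simp add: L2_fun_def)

lemma L2_norm_sq_nonneg [simp]: "0 \<le> L2_norm_sq M f"
  by (simp add: L2_norm_sq_def)

lemma L2_fun_integrable_norm_mult:
  assumes "f \<in> L2_fun M" "g \<in> L2_fun M"
  shows "integrable M (\<lambda>x. norm (f x) * norm (g x))"
proof (rule Bochner_Integration.integrable_bound)
  have [measurable]: "f \<in> borel_measurable M" "g \<in> borel_measurable M"
    using assms by (auto simp: L2_fun_def)
  show "integrable M (\<lambda>x. (norm (f x))\<^sup>2 + (norm (g x))\<^sup>2)"
    using assms by (auto simp: L2_fun_def)
  show "(\<lambda>x. norm (f x) * norm (g x)) \<in> borel_measurable M" by measurable
  have "a * b \<le> a\<^sup>2 + b\<^sup>2" if "a \<ge> 0" "b \<ge> 0" for a b :: real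
    using sum_squares_bound[of a b] mult_nonneg_nonneg[OF that] by linarith
  then show "AE x in M. norm (norm (f x) * norm (g x)) \<le> norm ((norm (f x))\<^sup>2 + (norm (g x))\<^sup>2)"
    by (simp add: abs_mult)
qed

lemma L2_fun_integrable_mult:
  assumes "f \<in> L2_fun M" "g \<in> L2_fun M"
  shows "integrable M (\<lambda>x. f x * g x)"
proof (rule Bochner_Integration.integrable_bound[OF L2_fun_integrable_norm_mult[OF assms]])
  have [measurable]: "f \<in> borel_measurable M" "g \<in> borel_measurable M"
    using assms by (auto simp: L2_fun_def)
  show "(\<lambda>x. f x * g x) \<in> borel_measurable M" by measurable
qed (simp add: norm_mult)

lemma L2_fun_conjg: "f \<in> L2_fun M \<Longrightarrow> (\<lambda>x. conjg (f x)) \<in> L2_fun M"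
  by (auto simp: L2_fun_def)

lemma L2_fun_cmult: "f \<in> L2_fun M \<Longrightarrow> (\<lambda>x. c * f x) \<in> L2_fun M"
  by (auto simp: L2_fun_def norm_mult power_mult_distrib)

lemma L2_fun_add:
  assumes "f \<in> L2_fun M" "g \<in> L2_fun M"
  shows "(\<lambda>x. f x + g x) \<in> L2_fun M"
proof -
  have [measurable]: "f \<in> borel_measurable M" "g \<in> borel_measurable M"
    using assms by (auto simp: L2_fun_def)
  have "integrable M (\<lambda>x. (norm (f x + g x))\<^sup>2)"
  proof (rule Bochner_Integration.integrable_bound)
    show "integrable M (\<lambda>x. (norm (f x))\<^sup>2 + 2 * (norm (f x) * norm (g x)) + (norm (g x))\<^sup>2)"
      using assms L2_fun_integrable_norm_mult[OF assms] by (auto simp: L2_fun_def)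
    have "(norm (f x + g x))\<^sup>2 \<le> (norm (f x))\<^sup>2 + 2 * (norm (f x) * norm (g x)) + (norm (g x))\<^sup>2" for x
      using power_mono[OF norm_triangle_ineq[of "f x" "g x"], of 2] by (simp add: power2_sum)
    then show "AE x in M. norm ((norm (f x + g x))\<^sup>2) \<le>
        norm ((norm (f x))\<^sup>2 + 2 * (norm (f x) * norm (g x)) + (norm (g x))\<^sup>2)"
      by simp
  qed measurable
  then show ?thesis by (simp add: L2_fun_def)
qed

lemma L2_fun_diff:
  assumes "f \<in> L2_fun M" "g \<in> L2_fun M"
  shows "(\<lambda>x. f x - g x) \<in> L2_fun M"
  using L2_fun_add[OF assms(1) L2_fun_cmult[OF assms(2), of "-1"]] by simp

lemma L2_fun_sum:
  assumes "\<And>i. i \<in> I \<Longrightarrow> f i \<in> L2_fun M"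
  shows "(\<lambda>x. \<Sum>i\<in>I. f i x) \<in> L2_fun M"
  using assms
proof (induction I rule: infinite_finite_induct)
  case (insert i I)
  then show ?case using L2_fun_add[of "f i" M "\<lambda>x. \<Sum>i\<in>I. f i x"] by simp
qed (simp_all add: L2_fun_def)

lemma L2_inner_self: "L2_inner M f f = of_real (L2_norm_sq M f)"
  for f :: "'a \<Rightarrow> 'k::real_or_complex"
proof -
  \<comment> \<open>The inner product with 1 is a left inverse of \<open>of_real\<close>, so the
    integral commutes with \<open>of_real\<close> without any integrability condition.\<close>
  have "(\<integral>x. of_real ((norm (f x))\<^sup>2) \<partial>M) = (of_real (\<integral>x. (norm (f x))\<^sup>2 \<partial>M) :: 'k)"
    by (rule integral_bounded_linear'[OF bounded_linear_of_real bounded_linear_inner_left[of 1]])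
       (simp add: of_real_def flip: power2_norm_eq_inner)
  then show ?thesis by (simp only: L2_inner_def L2_norm_sq_def mult_conjg)
qed

lemma L2_inner_commute: "L2_inner M g f = conjg (L2_inner M f g)"
  by (simp add: L2_inner_def mult.commute flip: integral_conjg)

lemma L2_inner_cmult_left: "L2_inner M (\<lambda>x. c * f x) g = c * L2_inner M f g"
  by (simp add: L2_inner_def mult.assoc)

lemma L2_inner_cmult_right: "L2_inner M f (\<lambda>x. c * g x) = conjg c * L2_inner M f g"
  by (simp add: L2_inner_def mult.left_commute)

lemma L2_inner_diff_left:
  assumes "f \<in> L2_fun M" "g \<in> L2_fun M" "h \<in> L2_fun M"
  shows "L2_inner M (\<lambda>x. f x - g x) h = L2_inner M f h - L2_inner M g h"
  using assms by (simp add: L2_inner_def left_diff_distrib L2_fun_integrable_mult L2_fun_conjg)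

lemma L2_inner_diff_right:
  assumes "f \<in> L2_fun M" "g \<in> L2_fun M" "h \<in> L2_fun M"
  shows "L2_inner M h (\<lambda>x. f x - g x) = L2_inner M h f - L2_inner M h g"
  using assms by (simp add: L2_inner_def conjg_diff right_diff_distrib L2_fun_integrable_mult L2_fun_conjg)

lemma L2_inner_sum_left:
  assumes "\<And>i. i \<in> I \<Longrightarrow> f i \<in> L2_fun M" "h \<in> L2_fun M"
  shows "L2_inner M (\<lambda>x. \<Sum>i\<in>I. f i x) h = (\<Sum>i\<in>I. L2_inner M (f i) h)"
  using assms by (simp add: L2_inner_def sum_distrib_right L2_fun_integrable_mult L2_fun_conjg)

lemma L2_inner_AE_cong:
  assumes "AE x in M. f x = f' x" "f \<in> borel_measurable M" "f' \<in> borel_measurable M"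
    "g \<in> borel_measurable M"
  shows "L2_inner M f g = L2_inner M f' g"
  unfolding L2_inner_def
proof (rule integral_cong_AE)
  note [measurable] = assms(2-)
  show "(\<lambda>x. f x * conjg (g x)) \<in> borel_measurable M" by measurable
  show "(\<lambda>x. f' x * conjg (g x)) \<in> borel_measurable M" by measurable
qed (use assms(1) in auto)

lemma L2_norm_sq_cmult: "L2_norm_sq M (\<lambda>x. c * f x) = (norm c)\<^sup>2 * L2_norm_sq M f"
  by (simp add: L2_norm_sq_def norm_mult power_mult_distrib)

lemma L2_norm_sq_eq_0_iff:
  assumes "f \<in> L2_fun M"
  shows "L2_norm_sq M f = 0 \<longleftrightarrow> (AE x in M. f x = 0)"
  using assms by (simp add: L2_norm_sq_def L2_fun_def integral_nonneg_eq_0_iff_AE)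

text \<open>The function being squared is \<open>A\<close> times the residual of projecting the
  modulus of \<open>g\<close> onto that of \<open>f\<close>; carrying the factor \<open>A\<close>
  avoids a division and leaves over the case \<open>A = 0\<close>, where \<open>f\<close> vanishes
  almost everywhere.\<close>

lemma L2_Cauchy_Schwarz:
  assumes f: "f \<in> L2_fun M" and g: "g \<in> L2_fun M"
  shows "(\<integral>x. norm (f x) * norm (g x) \<partial>M)\<^sup>2 \<le> L2_norm_sq M f * L2_norm_sq M g"
proof -
  define A B C where "A = L2_norm_sq M f" and "B = (\<integral>x. norm (f x) * norm (g x) \<partial>M)"
    and "C = L2_norm_sq M g"
  note int = L2_fun_integrable_norm_mult[OF f g]
  have intf: "integrable M (\<lambda>x. (norm (f x))\<^sup>2)" and intg: "integrable M (\<lambda>x. (norm (g x))\<^sup>2)"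
    using f g by (auto simp: L2_fun_def)
  have "0 \<le> (\<integral>x. (A * norm (g x) - B * norm (f x))\<^sup>2 \<partial>M)" by simp
  also have "\<dots> = (\<integral>x. A\<^sup>2 * (norm (g x))\<^sup>2 - 2 * A * B * (norm (f x) * norm (g x))
      + B\<^sup>2 * (norm (f x))\<^sup>2 \<partial>M)"
    by (simp add: power2_eq_square algebra_simps)
  also have "\<dots> = A\<^sup>2 * C - 2 * A * B * B + B\<^sup>2 * A"
    unfolding A_def C_def L2_norm_sq_def using int intf intg by (simp add: B_def)
  also have "\<dots> = A * (A * C - B\<^sup>2)" by (simp add: power2_eq_square algebra_simps)
  finally have *: "0 \<le> A * (A * C - B\<^sup>2)" .
  have "A \<ge> 0" by (simp add: A_def)
  show ?thesis
  proof (cases "A = 0")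
    case True
    then have "AE x in M. norm (f x) * norm (g x) = 0"
      using L2_norm_sq_eq_0_iff[OF f] by (auto simp: A_def)
    then have "B = 0" unfolding B_def by (rule integral_eq_zero_AE)
    then show ?thesis by (simp add: B_def)
  next
    case False
    then show ?thesis using * \<open>A \<ge> 0\<close> by (auto simp: zero_le_mult_iff A_def [symmetric] B_def [symmetric] C_def [symmetric])
  qed
qed

lemma (in finite_measure) L2_fun_bounded:
  fixes f :: "'a \<Rightarrow> 'k::real_or_complex"
  assumes [measurable]: "f \<in> borel_measurable M" and b: "\<And>x. x \<in> space M \<Longrightarrow> norm (f x) \<le> B"
  shows "f \<in> L2_fun M"
proof -
  have "integrable M (\<lambda>x. (norm (f x))\<^sup>2)"
    by (rule integrable_const_bound[where B = "B\<^sup>2"]) (auto intro!: AE_I2 power_mono b)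
  then show ?thesis by (simp add: L2_fun_def)
qed

lemma (in finite_measure) L2_fun_integrable:
  "f \<in> L2_fun M \<Longrightarrow> integrable M f" for f :: "'a \<Rightarrow> 'k::real_or_complex"
  using L2_fun_integrable_mult[of f M "\<lambda>_. 1"] L2_fun_bounded[of "\<lambda>_. 1 :: 'k" 1] by simp

lemma (in finite_measure) L2_norm_le:
  fixes f :: "'a \<Rightarrow> 'k::real_or_complex"
  assumes "f \<in> L2_fun M"
  shows "(\<integral>x. norm (f x) \<partial>M) \<le> sqrt (measure M (space M) * L2_norm_sq M f)"
proof -
  have "(\<lambda>_. 1 :: 'k) \<in> L2_fun M" by (rule L2_fun_bounded[where B = 1]) auto
  from L2_Cauchy_Schwarz[OF this assms] show ?thesis
    by (intro real_le_rsqrt) (simp add: L2_norm_sq_def)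
qed

section \<open>The integral operator of a Mercer kernel\<close>

locale mercer_setting = finite_measure \<nu>
  for X :: "'a::metric_space set" and K :: "'a \<Rightarrow> 'a \<Rightarrow> 'k::real_or_complex" and \<nu> :: "'a measure" +
  assumes compact_X: "compact X"
    and mercer: "mercer_kernel X K"
    and sets_\<nu>: "sets \<nu> = sets (restrict_space borel X)"
begin

abbreviation T :: "('a \<Rightarrow> 'k) \<Rightarrow> 'a \<Rightarrow> 'k" where "T \<equiv> integral_op \<nu> K"

lemma space_\<nu>: "space \<nu> = X"
  using sets_eq_imp_space_eq[OF sets_\<nu>] by (simp add: space_restrict_space)

lemma open_in_sets: "open U \<Longrightarrow> {x \<in> space \<nu>. x \<in> U} \<in> sets \<nu>"
  unfolding sets_\<nu> space_\<nu> sets_restrict_space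
  by (rule image_eqI[of _ _ U]) auto

lemma measurable_continuous:
  fixes f :: "'a \<Rightarrow> 'b::topological_space"
  assumes "continuous_on X f"
  shows "f \<in> borel_measurable \<nu>"
  using borel_measurable_continuous_on_restrict[OF assms] measurable_cong_sets[OF sets_\<nu> refl]
  by blast

lemma hermitian: "x \<in> X \<Longrightarrow> y \<in> X \<Longrightarrow> conjg (K x y) = K y x"
  using mercer unfolding mercer_kernel_def hermitian_kernel_def by metis

lemma continuous_K: "continuous_on (X \<times> X) (\<lambda>(x, y). K x y)"
  using mercer by (simp add: mercer_kernel_def)

lemma continuous_K_section: "x \<in> X \<Longrightarrow> continuous_on X (K x)"
  using continuous_on_compose2[OF continuous_K, of X "\<lambda>y. (x, y)"]
  by (fastforce intro: continuous_on_Pair continuous_on_const continuous_on_id)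

lemma measurable_K: "x \<in> X \<Longrightarrow> K x \<in> borel_measurable \<nu>"
  using measurable_continuous continuous_K_section by blast

lemma K_bounded: obtains C where "C > 0" "\<And>x y. x \<in> X \<Longrightarrow> y \<in> X \<Longrightarrow> norm (K x y) \<le> C"
proof -
  have "bounded ((\<lambda>(x, y). K x y) ` (X \<times> X))"
    by (intro compact_imp_bounded compact_continuous_image continuous_K compact_Times compact_X)
  then show ?thesis using that by (auto simp: bounded_pos)
qed

lemma K_uniformly_continuous:
  assumes "e > 0"
  obtains d where "d > 0"
    "\<And>x y u v. \<lbrakk>x \<in> X; y \<in> X; u \<in> X; v \<in> X; dist x u < d; dist y v < d\<rbrakk>
      \<Longrightarrow> norm (K x y - K u v) < e"
proof -
  have "uniformly_continuous_on (X \<times> X) (\<lambda>(x, y). K x y)"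
    by (intro compact_uniformly_continuous continuous_K compact_Times compact_X)
  then obtain d where d: "d > 0" "\<And>p q. \<lbrakk>p \<in> X \<times> X; q \<in> X \<times> X; dist q p < d\<rbrakk>
      \<Longrightarrow> dist ((\<lambda>(x, y). K x y) q) ((\<lambda>(x, y). K x y) p) < e"
    using \<open>e > 0\<close> unfolding uniformly_continuous_on_def by metis
  show ?thesis
  proof (rule that[of "d / 2"])
    fix x y u v assume *: "x \<in> X" "y \<in> X" "u \<in> X" "v \<in> X" "dist x u < d / 2" "dist y v < d / 2"
    have "dist (x, y) (u, v) \<le> dist x u + dist y v"
      by (simp add: dist_Pair_Pair sqrt_sum_squares_le_sum)
    then have "dist (x, y) (u, v) < d" using * by linarith
    then show "norm (K x y - K u v) < e" using d(2)[of "(u, v)" "(x, y)"] * by (simp add: dist_norm)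
  qed (use d in auto)
qed

section \<open>Bounds, equicontinuity and linearity of the operator\<close>

lemma integrable_mult_bounded:
  fixes f g :: "'a \<Rightarrow> 'k"
  assumes f: "integrable \<nu> f" and [measurable]: "g \<in> borel_measurable \<nu>"
    and B: "\<And>t. t \<in> X \<Longrightarrow> norm (g t) \<le> B"
  shows "integrable \<nu> (\<lambda>t. g t * f t)"
proof (rule Bochner_Integration.integrable_bound)
  have [measurable]: "f \<in> borel_measurable \<nu>" using f by auto
  show "integrable \<nu> (\<lambda>t. B *\<^sub>R f t)" using f by simp
  show "(\<lambda>t. g t * f t) \<in> borel_measurable \<nu>" by measurable
  show "AE t in \<nu>. norm (g t * f t) \<le> norm (B *\<^sub>R f t)"
  proof (rule AE_I2)
    fix t assume "t \<in> space \<nu>"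
    then have "norm (g t) \<le> \<bar>B\<bar>" using B[of t] by (simp add: space_\<nu>)
    then show "norm (g t * f t) \<le> norm (B *\<^sub>R f t)" by (simp add: norm_mult mult_right_mono)
  qed
qed

lemma integrable_K_mult:
  assumes "integrable \<nu> f" "x \<in> X"
  shows "integrable \<nu> (\<lambda>t. K x t * f t)"
proof -
  obtain C where "\<And>x y. x \<in> X \<Longrightarrow> y \<in> X \<Longrightarrow> norm (K x y) \<le> C" using K_bounded by metis
  then show ?thesis using assms measurable_K by (intro integrable_mult_bounded[where B = C]) auto
qed

lemma norm_integral_mult_le:
  fixes f g :: "'a \<Rightarrow> 'k"
  assumes f: "integrable \<nu> f" and gf: "integrable \<nu> (\<lambda>t. g t * f t)"
    and B: "\<And>t. t \<in> X \<Longrightarrow> norm (g t) \<le> B"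
  shows "norm (\<integral>t. g t * f t \<partial>\<nu>) \<le> B * (\<integral>t. norm (f t) \<partial>\<nu>)"
proof -
  have "norm (\<integral>t. g t * f t \<partial>\<nu>) \<le> (\<integral>t. norm (g t * f t) \<partial>\<nu>)" by simp
  also have "\<dots> \<le> (\<integral>t. B * norm (f t) \<partial>\<nu>)"
    using f integrable_norm[OF gf] B
    by (intro integral_mono) (auto simp: norm_mult space_\<nu> intro!: mult_right_mono)
  finally show ?thesis by simp
qed

lemma T_diff_le:
  assumes f: "integrable \<nu> f" and "x \<in> X" "y \<in> X"
    and "\<And>t. t \<in> X \<Longrightarrow> norm (K x t - K y t) \<le> e"
  shows "norm (T f x - T f y) \<le> e * (\<integral>t. norm (f t) \<partial>\<nu>)"
proof -
  have "T f x - T f y = (\<integral>t. (K x t - K y t) * f t \<partial>\<nu>)"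
    using assms integrable_K_mult by (simp add: integral_op_def left_diff_distrib)
  also have "norm \<dots> \<le> e * (\<integral>t. norm (f t) \<partial>\<nu>)"
    using assms integrable_K_mult by (intro norm_integral_mult_le) (auto simp: left_diff_distrib)
  finally show ?thesis .
qed

text \<open>The modulus \<open>d\<close> depends on \<open>f\<close> only through the bound
  \<open>M\<close> on its L^1 norm; this uniformity is what the compactness argument rests
  on.\<close>

lemma T_equicontinuous:
  assumes "e > 0"
  obtains d where "d > 0"
    "\<And>f x y. \<lbrakk>integrable \<nu> f; (\<integral>t. norm (f t) \<partial>\<nu>) \<le> M; x \<in> X; y \<in> X; dist x y < d\<rbrakk>
      \<Longrightarrow> norm (T f x - T f y) < e"
proof -
  \<comment> \<open>\<open>\<bar>M\<bar> + 1\<close> keeps the denominator positive for any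
    \<open>M\<close>, and the factor 2 makes the resulting inequality strict.\<close>
  define e' where "e' = e / (2 * (\<bar>M\<bar> + 1))"
  have e': "e' > 0" using assms by (simp add: e'_def)
  have "e' * M < e"
  proof -
    have "e' * M \<le> e' * (\<bar>M\<bar> + 1)" using e' by (intro mult_left_mono) auto
    also have "\<dots> = e / 2" unfolding e'_def by (simp add: divide_simps)
    finally show ?thesis using assms by simp
  qed
  obtain d where d: "d > 0"
    "\<And>x y u v. \<lbrakk>x \<in> X; y \<in> X; u \<in> X; v \<in> X; dist x u < d; dist y v < d\<rbrakk>
      \<Longrightarrow> norm (K x y - K u v) < e'"
    using K_uniformly_continuous[OF e'] by metis
  show ?thesis
  proof (rule that[OF d(1)])
    fix f :: "'a \<Rightarrow> 'k" and x y
    assume *: "integrable \<nu> f" "(\<integral>t. norm (f t) \<partial>\<nu>) \<le> M" "x \<in> X" "y \<in> X" "dist x y < d"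
    have "norm (T f x - T f y) \<le> e' * (\<integral>t. norm (f t) \<partial>\<nu>)"
      using * d by (intro T_diff_le) (auto intro!: less_imp_le)
    also have "\<dots> \<le> e' * M" using * e' by (intro mult_left_mono) auto
    also note \<open>e' * M < e\<close>
    finally show "norm (T f x - T f y) < e" .
  qed
qed

lemma continuous_T:
  assumes "integrable \<nu> f"
  shows "continuous_on X (T f)"
  unfolding continuous_on_iff
proof (intro ballI allI impI)
  fix x e :: real assume "e > 0"
  obtain d where d: "d > 0"
    "\<And>f' x y. \<lbrakk>integrable \<nu> f'; (\<integral>t. norm (f' t) \<partial>\<nu>) \<le> (\<integral>t. norm (f t) \<partial>\<nu>); x \<in> X; y \<in> X; dist x y < d\<rbrakk>
      \<Longrightarrow> norm (T f' x - T f' y) < e"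
    using T_equicontinuous[OF \<open>e > 0\<close>] by metis
  fix x assume "x \<in> X"
  then show "\<exists>d>0. \<forall>x'\<in>X. dist x' x < d \<longrightarrow> dist (T f x') (T f x) < e"
    using d assms by (intro exI[of _ d]) (auto simp: dist_norm)
qed

lemma T_bounded:
  obtains C where "C > 0" "\<And>f x. integrable \<nu> f \<Longrightarrow> x \<in> X \<Longrightarrow> norm (T f x) \<le> C * (\<integral>t. norm (f t) \<partial>\<nu>)"
proof -
  obtain C where "C > 0" "\<And>x y. x \<in> X \<Longrightarrow> y \<in> X \<Longrightarrow> norm (K x y) \<le> C" using K_bounded by metis
  then show ?thesis
    using that[of C] unfolding integral_op_def
    by (metis norm_integral_mult_le integrable_K_mult)
qed

text \<open>Smoothing from L^2 to the sup norm: a function that is small in L^2 has an image that is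
  small at every point of \<open>X\<close>.\<close>

lemma T_bounded_L2:
  obtains C where "C > 0"
    "\<And>f x. f \<in> L2_fun \<nu> \<Longrightarrow> x \<in> X \<Longrightarrow> norm (T f x) \<le> C * sqrt (L2_norm_sq \<nu> f)"
proof -
  obtain C where C: "C > 0"
    "\<And>f x. integrable \<nu> f \<Longrightarrow> x \<in> X \<Longrightarrow> norm (T f x) \<le> C * (\<integral>t. norm (f t) \<partial>\<nu>)"
    using T_bounded by metis
  \<comment> \<open>The summand 1 keeps \<open>D\<close> positive when \<open>\<nu>\<close> is the
    zero measure.\<close>
  define D where "D = C * (sqrt (measure \<nu> (space \<nu>)) + 1)"
  show ?thesis
  proof (rule that[of D])
    show "D > 0" using C by (simp add: D_def add_nonneg_pos)
    fix f :: "'a \<Rightarrow> 'k" and x assume f: "f \<in> L2_fun \<nu>" and x: "x \<in> X"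
    have "norm (T f x) \<le> C * (\<integral>t. norm (f t) \<partial>\<nu>)" using C f x L2_fun_integrable by blast
    also have "\<dots> \<le> C * (sqrt (measure \<nu> (space \<nu>)) * sqrt (L2_norm_sq \<nu> f))"
      using L2_norm_le[OF f] C by (simp add: real_sqrt_mult)
    also have "\<dots> \<le> D * sqrt (L2_norm_sq \<nu> f)"
      using C by (simp add: D_def algebra_simps)
    finally show "norm (T f x) \<le> D * sqrt (L2_norm_sq \<nu> f)" .
  qed
qed

lemma measurable_T: "integrable \<nu> f \<Longrightarrow> T f \<in> borel_measurable \<nu>"
  by (rule measurable_continuous[OF continuous_T])

lemma L2_fun_continuous:
  fixes f :: "'a \<Rightarrow> 'k"
  assumes "continuous_on X f"
  shows "f \<in> L2_fun \<nu>"
proof -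
  have "bounded (f ` X)"
    using assms compact_X compact_continuous_image compact_imp_bounded by blast
  then obtain B where "\<And>x. x \<in> X \<Longrightarrow> norm (f x) \<le> B" by (auto simp: bounded_iff)
  then show ?thesis
    using assms measurable_continuous by (intro L2_fun_bounded) (auto simp: space_\<nu>)
qed

lemma T_L2: "f \<in> L2_fun \<nu> \<Longrightarrow> T f \<in> L2_fun \<nu>"
  using L2_fun_continuous continuous_T L2_fun_integrable by blast

lemma T_cmult: "T (\<lambda>t. c * f t) x = c * T f x"
  by (simp add: integral_op_def mult.left_commute)

lemma T_diff:
  assumes "f \<in> L2_fun \<nu>" "g \<in> L2_fun \<nu>" "x \<in> X"
  shows "T (\<lambda>t. f t - g t) x = T f x - T g x"
  using assms by (simp add: integral_op_def right_diff_distrib integrable_K_mult L2_fun_integrable)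

lemma T_sum:
  assumes "\<And>i. i \<in> I \<Longrightarrow> f i \<in> L2_fun \<nu>" "x \<in> X"
  shows "T (\<lambda>t. \<Sum>i\<in>I. f i t) x = (\<Sum>i\<in>I. T (f i) x)"
  using assms by (simp add: integral_op_def sum_distrib_left integrable_K_mult L2_fun_integrable)

section \<open>Finite nets and approximation of the operator by finite sums\<close>

text \<open>\<open>s\<close> has to be measurable into the discrete space, so that
  \<open>h (s t)\<close> is measurable for arbitrary \<open>h\<close>. It is therefore built by
  induction on the centres, each new ball overriding the earlier choice.\<close>

lemma finite_net:
  assumes "d > 0"
  obtains P s where "finite P" "P \<subseteq> X" "s \<in> measurable \<nu> (count_space UNIV)"
    "\<And>t. t \<in> X \<Longrightarrow> s t \<in> P" "\<And>t. t \<in> X \<Longrightarrow> dist t (s t) < d"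
proof -
  obtain P where P: "finite P" "P \<subseteq> X" "X \<subseteq> (\<Union>p\<in>P. ball p d)"
    using compactE_image[OF compact_X, of X "\<lambda>p. ball p d"] assms by force
  have "\<exists>s. s \<in> measurable \<nu> (count_space UNIV) \<and> (\<forall>t\<in>(\<Union>p\<in>P. ball p d). s t \<in> P \<and> dist t (s t) < d)"
    using P(1)
  proof induction
    case (insert p P)
    then obtain s where s: "s \<in> measurable \<nu> (count_space UNIV)"
      "\<forall>t\<in>(\<Union>p\<in>P. ball p d). s t \<in> P \<and> dist t (s t) < d" by blast
    have "(\<lambda>t. if t \<in> ball p d then p else s t) \<in> measurable \<nu> (count_space UNIV)"
      by (intro measurable_If s open_in_sets) auto
    then show ?case using s(2)
      by (intro exI[of _ "\<lambda>t. if t \<in> ball p d then p else s t"]) (auto simp: dist_commute)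
  \<comment> \<open>With no centres the union of balls is empty, so the default value is
    unconstrained.\<close>
  qed (auto intro!: exI[of _ "\<lambda>_. undefined"])
  then obtain s where "s \<in> measurable \<nu> (count_space UNIV)"
    "\<forall>t\<in>(\<Union>p\<in>P. ball p d). s t \<in> P \<and> dist t (s t) < d" by blast
  then show ?thesis using P by (intro that[of P s]) auto
qed

text \<open>
  Replacing \<open>K x y\<close> by its value at nearby points of a finite net turns integrals against \<open>K\<close>
  into finite sums with weights \<open>a q f\<close>, the integral of \<open>f\<close> over the cell of \<open>q\<close>. Symmetry and
  positivity of \<open>T\<close> are thus inherited from the kernel without any product measure, on which the
  continuous kernel would not obviously be measurable.
\<close>

lemma discretization:
  assumes "e > 0"
  obtains P :: "'a set" and a :: "'a \<Rightarrow> ('a \<Rightarrow> 'k) \<Rightarrow> 'k" where "finite P" "P \<subseteq> X"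
    "\<And>q f. a q (\<lambda>t. conjg (f t)) = conjg (a q f)"
    "\<And>f x. \<lbrakk>integrable \<nu> f; x \<in> X\<rbrakk> \<Longrightarrow>
       norm (T f x - (\<Sum>q\<in>P. K x q * a q f)) \<le> e * (\<integral>t. norm (f t) \<partial>\<nu>)"
    "\<And>f g. \<lbrakk>integrable \<nu> f; integrable \<nu> g\<rbrakk> \<Longrightarrow>
       norm ((\<integral>u. T f u * g u \<partial>\<nu>) - (\<Sum>p\<in>P. \<Sum>q\<in>P. K p q * a q f * a p g))
         \<le> e * (\<integral>t. norm (f t) \<partial>\<nu>) * (\<integral>t. norm (g t) \<partial>\<nu>)"
proof -
  obtain d where d: "d > 0"
    "\<And>x y u v. \<lbrakk>x \<in> X; y \<in> X; u \<in> X; v \<in> X; dist x u < d; dist y v < d\<rbrakk>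
      \<Longrightarrow> norm (K x y - K u v) < e"
    using K_uniformly_continuous[OF assms] by metis
  obtain P s where P: "finite P" "P \<subseteq> X" and [measurable]: "s \<in> measurable \<nu> (count_space UNIV)"
    and s: "\<And>t. t \<in> X \<Longrightarrow> s t \<in> P" "\<And>t. t \<in> X \<Longrightarrow> dist t (s t) < d"
    using finite_net[OF d(1)] by metis
  have sX: "s t \<in> X" if "t \<in> X" for t using s P that by blast
  define a :: "'a \<Rightarrow> ('a \<Rightarrow> 'k) \<Rightarrow> 'k" where
    "a q f = (\<integral>t. indicator {t. s t = q} t *\<^sub>R f t \<partial>\<nu>)" for q f
  have a_int: "integrable \<nu> (\<lambda>t. indicator {t. s t = q} t *\<^sub>R f t)"
    if f: "integrable \<nu> f" for q and f :: "'a \<Rightarrow> 'k"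
  proof (rule Bochner_Integration.integrable_bound[OF f])
    have [measurable]: "f \<in> borel_measurable \<nu>" using f by auto
    show "(\<lambda>t. indicator {t. s t = q} t *\<^sub>R f t) \<in> borel_measurable \<nu>" by measurable
  qed (simp add: indicator_def)
  \<comment> \<open>\<open>h (s t)\<close> is constant on each cell of the net. Used for both
    variables: with a row of \<open>K\<close>, and later with the discretized image
    \<open>S\<close>.\<close>
  have step: "integrable \<nu> (\<lambda>t. h (s t) * f t)" "(\<integral>t. h (s t) * f t \<partial>\<nu>) = (\<Sum>q\<in>P. h q * a q f)"
    if f: "integrable \<nu> f" for f and h :: "'a \<Rightarrow> 'k"
  proof -
    have *: "h (s t) * f t = (\<Sum>q\<in>P. h q * (indicator {t. s t = q} t *\<^sub>R f t))"
      if "t \<in> space \<nu>" for t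
    proof -
      have "(\<Sum>q\<in>P. h q * (indicator {t. s t = q} t *\<^sub>R f t))
          = (\<Sum>q\<in>P. if s t = q then h q * f t else 0)"
        by (intro sum.cong) (auto simp: indicator_def)
      then show ?thesis using s(1)[of t] that P(1) by (simp add: space_\<nu>)
    qed
    show "integrable \<nu> (\<lambda>t. h (s t) * f t)"
      using a_int[OF f] by (subst Bochner_Integration.integrable_cong[OF refl *]) (auto simp del: mult_scaleR_right)
    show "(\<integral>t. h (s t) * f t \<partial>\<nu>) = (\<Sum>q\<in>P. h q * a q f)"
      using a_int[OF f] by (subst Bochner_Integration.integral_cong[OF refl *]) (auto simp: a_def simp del: mult_scaleR_right)
  qed
  \<comment> \<open>The row of \<open>K\<close> is taken at a point \<open>y\<close> near
    \<open>x\<close> rather than at \<open>x\<close>, because in the bilinear estimate the outer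
    variable \<open>u\<close> is replaced by \<open>s u\<close> as well.\<close>
  have approx: "norm (T f x - (\<Sum>q\<in>P. K y q * a q f)) \<le> e * (\<integral>t. norm (f t) \<partial>\<nu>)"
    if f: "integrable \<nu> f" and x: "x \<in> X" and y: "y \<in> X" "dist x y < d" for f x y
  proof -
    have "T f x - (\<Sum>q\<in>P. K y q * a q f) = (\<integral>t. (K x t - K y (s t)) * f t \<partial>\<nu>)"
      using step[OF f, of "K y"] integrable_K_mult[OF f x]
      by (simp add: integral_op_def left_diff_distrib)
    also have "norm \<dots> \<le> e * (\<integral>t. norm (f t) \<partial>\<nu>)"
    proof (rule norm_integral_mult_le[OF f])
      show "integrable \<nu> (\<lambda>t. (K x t - K y (s t)) * f t)"
        using step[OF f, of "K y"] integrable_K_mult[OF f x] by (simp add: left_diff_distrib)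
      show "norm (K x t - K y (s t)) \<le> e" if "t \<in> X" for t
        using d(2)[of x t y "s t"] x y s[OF that] sX[OF that] that by simp
    qed
    finally show ?thesis .
  qed
  show ?thesis
  proof (rule that[OF P, of a])
    show "a q (\<lambda>t. conjg (f t)) = conjg (a q f)" for q f
      by (simp add: a_def conjg_scaleR flip: integral_conjg)
  next
    fix f :: "'a \<Rightarrow> 'k" and x
    assume "integrable \<nu> f" "x \<in> X"
    then show "norm (T f x - (\<Sum>q\<in>P. K x q * a q f)) \<le> e * (\<integral>t. norm (f t) \<partial>\<nu>)"
      using approx d(1) by simp
  next
    fix f g :: "'a \<Rightarrow> 'k"
    assume f: "integrable \<nu> f" and g: "integrable \<nu> g"
    define S where "S u = (\<Sum>q\<in>P. K u q * a q f)" for u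
    obtain C where C: "C > 0"
      "\<And>f x. integrable \<nu> f \<Longrightarrow> x \<in> X \<Longrightarrow> norm (T f x) \<le> C * (\<integral>t. norm (f t) \<partial>\<nu>)"
      using T_bounded by metis
    have Tg: "integrable \<nu> (\<lambda>u. T f u * g u)"
      using C(2)[OF f] measurable_T[OF f] by (intro integrable_mult_bounded[OF g])
    have "(\<Sum>p\<in>P. \<Sum>q\<in>P. K p q * a q f * a p g) = (\<Sum>p\<in>P. S p * a p g)"
      by (simp add: S_def sum_distrib_right)
    then have "(\<integral>u. T f u * g u \<partial>\<nu>) - (\<Sum>p\<in>P. \<Sum>q\<in>P. K p q * a q f * a p g)
        = (\<integral>u. (T f u - S (s u)) * g u \<partial>\<nu>)"
      using step[OF g, of S] Tg by (simp add: left_diff_distrib)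
    also have "norm \<dots> \<le> e * (\<integral>t. norm (f t) \<partial>\<nu>) * (\<integral>t. norm (g t) \<partial>\<nu>)"
    proof (rule norm_integral_mult_le[OF g])
      show "integrable \<nu> (\<lambda>u. (T f u - S (s u)) * g u)"
        using step[OF g, of S] Tg by (simp add: left_diff_distrib)
      show "norm (T f u - S (s u)) \<le> e * (\<integral>t. norm (f t) \<partial>\<nu>)" if "u \<in> X" for u
        unfolding S_def using that f s sX by (intro approx) auto
    qed
    finally show "norm ((\<integral>u. T f u * g u \<partial>\<nu>) - (\<Sum>p\<in>P. \<Sum>q\<in>P. K p q * a q f * a p g))
         \<le> e * (\<integral>t. norm (f t) \<partial>\<nu>) * (\<integral>t. norm (g t) \<partial>\<nu>)" .
  qed
qed

lemma T_self_adjoint: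
  assumes f: "f \<in> L2_fun \<nu>" and g: "g \<in> L2_fun \<nu>"
  shows "L2_inner \<nu> (T f) g = L2_inner \<nu> f (T g)"
proof -
  have intf: "integrable \<nu> f" and intg: "integrable \<nu> g" using f g L2_fun_integrable by auto
  define B where "B = 2 * (\<integral>t. norm (f t) \<partial>\<nu>) * (\<integral>t. norm (g t) \<partial>\<nu>)"
  have est: "norm (L2_inner \<nu> (T f) g - L2_inner \<nu> f (T g)) \<le> e * B" if e: "e > 0" for e
  proof -
    obtain P a where P: "finite P" "P \<subseteq> X"
      and ca: "\<And>q f. a q (\<lambda>t. conjg (f t)) = conjg (a q f)"
      and "\<And>f x. \<lbrakk>integrable \<nu> f; x \<in> X\<rbrakk> \<Longrightarrow>
       norm (T f x - (\<Sum>q\<in>P. K x q * a q f)) \<le> e * (\<integral>t. norm (f t) \<partial>\<nu>)"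
      and ap: "\<And>f g. \<lbrakk>integrable \<nu> f; integrable \<nu> g\<rbrakk> \<Longrightarrow>
       norm ((\<integral>u. T f u * g u \<partial>\<nu>) - (\<Sum>p\<in>P. \<Sum>q\<in>P. K p q * a q f * a p g))
         \<le> e * (\<integral>t. norm (f t) \<partial>\<nu>) * (\<integral>t. norm (g t) \<partial>\<nu>)"
      by (rule discretization[OF e]) (rule that; assumption)
    define S where "S f g = (\<Sum>p\<in>P. \<Sum>q\<in>P. K p q * a q f * a p (\<lambda>t. conjg (g t)))" for f g
    have 1: "norm (L2_inner \<nu> (T f) g - S f g)
        \<le> e * (\<integral>t. norm (f t) \<partial>\<nu>) * (\<integral>t. norm (g t) \<partial>\<nu>)"
      using ap[OF intf integrable_conjg[OF intg]] by (simp add: L2_inner_def S_def)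
    have 2: "norm (L2_inner \<nu> (T g) f - S g f)
        \<le> e * (\<integral>t. norm (g t) \<partial>\<nu>) * (\<integral>t. norm (f t) \<partial>\<nu>)"
      using ap[OF intg integrable_conjg[OF intf]] by (simp add: L2_inner_def S_def)
    \<comment> \<open>Interchanging two finite sums takes the place of Fubini; Hermitian symmetry of
      \<open>K\<close> restores the original summand.\<close>
    have "conjg (S g f) = (\<Sum>p\<in>P. \<Sum>q\<in>P. K q p * conjg (a q g) * a p f)"
      unfolding S_def conjg_sum using P(2) by (intro sum.cong refl) (auto simp: ca hermitian subsetD)
    also have "\<dots> = S f g"
      unfolding S_def by (subst sum.swap) (simp add: ca mult_ac)
    finally have 3: "conjg (S g f) = S f g" .
    have "norm (L2_inner \<nu> f (T g) - S f g) = norm (conjg (L2_inner \<nu> (T g) f - S g f))"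
      by (simp only: conjg_diff 3 L2_inner_commute[of \<nu> f "T g"])
    then have "norm (L2_inner \<nu> f (T g) - S f g) \<le> e * (\<integral>t. norm (g t) \<partial>\<nu>) * (\<integral>t. norm (f t) \<partial>\<nu>)"
      using 2 by simp
    then show ?thesis
      using 1 norm_triangle_ineq4[of "L2_inner \<nu> (T f) g - S f g" "L2_inner \<nu> f (T g) - S f g"]
      by (simp add: B_def algebra_simps)
  qed
  have "B \<ge> 0" by (simp add: B_def)
  have "norm (L2_inner \<nu> (T f) g - L2_inner \<nu> f (T g)) \<le> 0"
  proof (rule field_le_epsilon)
    fix e :: real assume "e > 0"
    have "norm (L2_inner \<nu> (T f) g - L2_inner \<nu> f (T g)) \<le> e / (B + 1) * B"
      using \<open>e > 0\<close> \<open>B \<ge> 0\<close> by (intro est) simp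
    also have "\<dots> \<le> e" using \<open>e > 0\<close> \<open>B \<ge> 0\<close> by (simp add: field_simps)
    finally show "norm (L2_inner \<nu> (T f) g - L2_inner \<nu> f (T g)) \<le> 0 + e" by simp
  qed
  then show ?thesis by simp
qed

text \<open>The nonvanishing set of \<open>f\<close> is relatively open and null, so it cannot be a
  neighbourhood of a point of the support.\<close>

lemma zero_on_measure_supp:
  fixes f :: "'a \<Rightarrow> 'k"
  assumes f: "continuous_on X f" and ae: "AE t in \<nu>. f t = 0" and x: "x \<in> measure_supp X \<nu>"
  shows "f x = 0"
proof (rule ccontr)
  assume "f x \<noteq> 0"
  define V where "V = {t \<in> X. f t \<noteq> 0}"
  have "openin (top_of_set X) V"
  proof -
    have "V = X \<inter> f -` (- {0})" by (auto simp: V_def)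
    then show ?thesis using continuous_openin_preimage_gen[OF f, of "- {0}"] by (simp add: open_Compl)
  qed
  moreover have "x \<in> V" using x \<open>f x \<noteq> 0\<close> by (simp add: V_def measure_supp_def)
  ultimately have "emeasure \<nu> V \<noteq> 0" using x unfolding measure_supp_def by blast
  moreover have "emeasure \<nu> V = 0"
  proof -
    have [measurable]: "f \<in> borel_measurable \<nu>" using measurable_continuous[OF f] .
    have "{t \<in> space \<nu>. f t \<noteq> 0} \<in> sets \<nu>" by measurable
    then show ?thesis using ae AE_iff_measurable[of V \<nu> "\<lambda>t. f t = 0"] by (simp add: V_def space_\<nu>)
  qed
  ultimately show False by simp
qed

text \<open>Dominated by \<open>B * norm (w t)\<close>. Different choices of \<open>w\<close> give
  limits of inner products, limits of \<open>T\<close> along a sequence (with a row of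
  \<open>K\<close>), and termwise integration of the Mercer series.\<close>

lemma bounded_convergence:
  fixes F :: "nat \<Rightarrow> 'a \<Rightarrow> 'k"
  assumes w: "integrable \<nu> w" and F[measurable]: "\<And>n. F n \<in> borel_measurable \<nu>"
    and h[measurable]: "h \<in> borel_measurable \<nu>"
    and B: "\<And>n t. t \<in> X \<Longrightarrow> norm (F n t) \<le> B"
    and lim: "\<And>t. t \<in> X \<Longrightarrow> (\<lambda>n. F n t) \<longlonglongrightarrow> h t"
  shows "(\<lambda>n. \<integral>t. F n t * w t \<partial>\<nu>) \<longlonglongrightarrow> (\<integral>t. h t * w t \<partial>\<nu>)"
proof (rule integral_dominated_convergence)
  have [measurable]: "w \<in> borel_measurable \<nu>" using w by auto
  show "(\<lambda>t. h t * w t) \<in> borel_measurable \<nu>" "\<And>n. (\<lambda>t. F n t * w t) \<in> borel_measurable \<nu>"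
    by measurable
  show "integrable \<nu> (\<lambda>t. B * norm (w t))" using w by simp
  show "AE t in \<nu>. (\<lambda>n. F n t * w t) \<longlonglongrightarrow> h t * w t"
    by (rule AE_I2) (auto simp: space_\<nu> intro!: tendsto_mult_right lim)
  show "AE t in \<nu>. norm (F n t * w t) \<le> B * norm (w t)" for n
    by (rule AE_I2) (auto simp: space_\<nu> norm_mult intro!: mult_right_mono B)
qed

text \<open>The point \<open>x\<close> takes index 0 with coefficient 1, and an enumeration of
  \<open>P\<close> follows. It does no harm if \<open>x\<close> lies in \<open>P\<close>, since
  \<open>psd_kernel\<close> admits repeated points.\<close>

lemma psd_finite:
  assumes x: "x \<in> X" and P: "finite P" "P \<subseteq> X"
  shows "K x x + (\<Sum>q\<in>P. K x q * \<alpha> q) + conjg (\<Sum>q\<in>P. K x q * \<alpha> q)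
       + (\<Sum>p\<in>P. \<Sum>q\<in>P. K p q * \<alpha> q * conjg (\<alpha> p)) \<in> \<real>\<^sub>\<ge>\<^sub>0"
proof -
  obtain h n where h: "bij_betw h {..<n::nat} P"
    using ex_bij_betw_nat_finite[OF P(1)] by (auto simp: atLeast0LessThan)
  have hX: "h i \<in> X" if "i < n" for i using h P(2) that by (auto simp: bij_betw_def)
  define pt where "pt i = (case i of 0 \<Rightarrow> x | Suc i \<Rightarrow> h i)" for i
  define \<beta> where "\<beta> i = (case i of 0 \<Rightarrow> 1 | Suc i \<Rightarrow> \<alpha> (h i))" for i
  have "\<forall>i<Suc n. pt i \<in> X" using x hX by (auto simp: pt_def split: nat.split)
  then have "(\<Sum>i<Suc n. \<Sum>j<Suc n. conjg (\<beta> i) * \<beta> j * K (pt i) (pt j)) \<in> \<real>\<^sub>\<ge>\<^sub>0"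
    using mercer unfolding mercer_kernel_def psd_kernel_def by blast
  also have "(\<Sum>i<Suc n. \<Sum>j<Suc n. conjg (\<beta> i) * \<beta> j * K (pt i) (pt j))
      = K x x + (\<Sum>j<n. K x (h j) * \<alpha> (h j)) + ((\<Sum>i<n. conjg (\<alpha> (h i)) * K (h i) x)
        + (\<Sum>i<n. \<Sum>j<n. K (h i) (h j) * \<alpha> (h j) * conjg (\<alpha> (h i))))"
    unfolding sum.lessThan_Suc_shift by (simp add: \<beta>_def pt_def sum.distrib mult_ac)
  also have "(\<Sum>i<n. conjg (\<alpha> (h i)) * K (h i) x) = conjg (\<Sum>j<n. K x (h j) * \<alpha> (h j))"
    unfolding conjg_sum using x hX by (intro sum.cong) (auto simp: hermitian)
  also have "(\<Sum>j<n. K x (h j) * \<alpha> (h j)) = (\<Sum>q\<in>P. K x q * \<alpha> q)"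
    by (rule sum.reindex_bij_betw[OF h, of "\<lambda>q. K x q * \<alpha> q"])
  also have "(\<Sum>i<n. \<Sum>j<n. K (h i) (h j) * \<alpha> (h j) * conjg (\<alpha> (h i)))
      = (\<Sum>i<n. \<Sum>q\<in>P. K (h i) q * \<alpha> q * conjg (\<alpha> (h i)))"
    by (intro sum.cong refl sum.reindex_bij_betw[OF h, of "\<lambda>q. K (h i) q * \<alpha> q * conjg (\<alpha> (h i))" for i])
  also have "\<dots> = (\<Sum>p\<in>P. \<Sum>q\<in>P. K p q * \<alpha> q * conjg (\<alpha> p))"
    by (rule sum.reindex_bij_betw[OF h, of "\<lambda>p. \<Sum>q\<in>P. K p q * \<alpha> q * conjg (\<alpha> p)"])
  finally show ?thesis by (simp add: add.assoc)
qed

text \<open>Positivity of the kernel tested against the measure \<open>\<delta>\<^sub>x + f \<nu>\<close>.\<close>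

lemma psd_integral:
  assumes x: "x \<in> X" and f: "integrable \<nu> f"
  shows "K x x + T f x + conjg (T f x) + L2_inner \<nu> (T f) f \<in> \<real>\<^sub>\<ge>\<^sub>0" (is "?Q \<in> _")
proof -
  define F where "F = (\<integral>t. norm (f t) \<partial>\<nu>)"
  have "F \<ge> 0" by (simp add: F_def)
  \<comment> \<open>The discretized form is nonnegative by \<open>psd_finite\<close>; the error
    collects \<open>e * F\<close> from each of the two linear terms and \<open>e * F * F\<close>
    from the quadratic one.\<close>
  have est: "\<exists>q\<in>\<real>\<^sub>\<ge>\<^sub>0. norm (q - ?Q) \<le> e * (2 * F + F * F)" if e: "e > 0" for e
  proof -
    obtain P a where P: "finite P" "P \<subseteq> X"
      and ca: "\<And>q f. a q (\<lambda>t. conjg (f t)) = conjg (a q f)"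
      and ap1: "\<And>f x. \<lbrakk>integrable \<nu> f; x \<in> X\<rbrakk> \<Longrightarrow>
       norm (T f x - (\<Sum>q\<in>P. K x q * a q f)) \<le> e * (\<integral>t. norm (f t) \<partial>\<nu>)"
      and ap2: "\<And>f g. \<lbrakk>integrable \<nu> f; integrable \<nu> g\<rbrakk> \<Longrightarrow>
       norm ((\<integral>u. T f u * g u \<partial>\<nu>) - (\<Sum>p\<in>P. \<Sum>q\<in>P. K p q * a q f * a p g))
         \<le> e * (\<integral>t. norm (f t) \<partial>\<nu>) * (\<integral>t. norm (g t) \<partial>\<nu>)"
      by (rule discretization[OF e]) (rule that; assumption)
    define S1 where "S1 = (\<Sum>q\<in>P. K x q * a q f)"
    define S2 where "S2 = (\<Sum>p\<in>P. \<Sum>q\<in>P. K p q * a q f * conjg (a p f))"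
    have 1: "norm (T f x - S1) \<le> e * F" using ap1[OF f x] by (simp add: S1_def F_def)
    have 2: "norm (L2_inner \<nu> (T f) f - S2) \<le> e * F * F"
      using ap2[OF f integrable_conjg[OF f]] by (simp add: S2_def F_def L2_inner_def ca)
    have 3: "norm (conjg (T f x) - conjg S1) \<le> e * F" using 1 norm_conjg[of "T f x - S1"]
      by (simp only: conjg_diff)
    have "K x x + S1 + conjg S1 + S2 \<in> \<real>\<^sub>\<ge>\<^sub>0"
      unfolding S1_def S2_def by (rule psd_finite[OF x P])
    moreover have "norm (K x x + S1 + conjg S1 + S2 - ?Q) \<le> e * (2 * F + F * F)"
    proof -
      have "norm (K x x + S1 + conjg S1 + S2 - ?Q) =
        norm ((T f x - S1) + (conjg (T f x) - conjg S1) + (L2_inner \<nu> (T f) f - S2))"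
        by (subst norm_minus_commute) (simp add: algebra_simps)
      also have "\<dots> \<le> e * F + e * F + e * F * F"
        by (intro order_trans[OF norm_triangle_ineq] add_mono 1 2 3)
      finally show ?thesis by (simp add: algebra_simps)
    qed
    ultimately show ?thesis by blast
  qed
  have "?Q \<in> closure \<real>\<^sub>\<ge>\<^sub>0"
    unfolding closure_approachable
  proof (intro allI impI)
    fix e :: real assume "e > 0"
    define c where "c = 2 * F + F * F + 1"
    have "c > 0" using \<open>F \<ge> 0\<close> by (simp add: c_def add_nonneg_pos)
    obtain q where "q \<in> \<real>\<^sub>\<ge>\<^sub>0" "norm (q - ?Q) \<le> e / c * (2 * F + F * F)"
      using est[of "e / c"] \<open>e > 0\<close> \<open>c > 0\<close> by auto
    moreover have "e / c * (2 * F + F * F) < e"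
      using \<open>e > 0\<close> \<open>c > 0\<close> by (simp add: c_def field_simps)
    ultimately show "\<exists>q\<in>\<real>\<^sub>\<ge>\<^sub>0. dist q ?Q < e"
      unfolding dist_norm by (meson le_less_trans)
  qed
  then show ?thesis using closed_nonneg_Reals closure_closed by blast
qed

text \<open>Positivity at a single point: with empty \<open>P\<close> only the diagonal term
  remains.\<close>

lemma K_diag: "x \<in> X \<Longrightarrow> K x x = of_real (norm (K x x))"
  using psd_finite[of x "{}"] by (simp flip: nonneg_Reals_iff_norm)

lemma L2_inner_cong:
  "(\<And>x. x \<in> X \<Longrightarrow> f x = f' x) \<Longrightarrow> L2_inner \<nu> f g = L2_inner \<nu> f' g"
  unfolding L2_inner_def by (rule Bochner_Integration.integral_cong) (auto simp: space_\<nu>)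

section \<open>Compactness\<close>

text \<open>An Arzela-Ascoli argument: a diagonal subsequence converges on the countable dense union
  \<open>R\<close> of finite nets, and equicontinuity of the images carries the Cauchy property to
  all of \<open>X\<close>.\<close>

lemma T_compact:
  assumes g: "\<And>n. g n \<in> L2_fun \<nu>" and g_norm: "\<And>n. L2_norm_sq \<nu> (g n) \<le> 1"
  obtains k h where "strict_mono (k :: nat \<Rightarrow> nat)" "\<And>x. x \<in> X \<Longrightarrow> (\<lambda>n. T (g (k n)) x) \<longlonglongrightarrow> h x"
proof -
  obtain C where C: "C > 0"
    "\<And>f x. f \<in> L2_fun \<nu> \<Longrightarrow> x \<in> X \<Longrightarrow> norm (T f x) \<le> C * sqrt (L2_norm_sq \<nu> f)"
    using T_bounded_L2 by metis
  have bound: "norm (T (g n) x) \<le> C" if "x \<in> X" for n x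
  proof -
    have "C * sqrt (L2_norm_sq \<nu> (g n)) \<le> C * 1"
      using C(1) g_norm[of n] by (intro mult_left_mono) auto
    then show ?thesis using C(2)[OF g that, of n] by linarith
  qed
  have int: "integrable \<nu> (g n)" for n using g L2_fun_integrable by blast
  have L1: "(\<integral>t. norm (g n t) \<partial>\<nu>) \<le> sqrt (measure \<nu> (space \<nu>))" for n
  proof -
    have "measure \<nu> (space \<nu>) * L2_norm_sq \<nu> (g n) \<le> measure \<nu> (space \<nu>) * 1"
      using g_norm by (intro mult_left_mono) auto
    then show ?thesis using L2_norm_le[OF g, of n] by (simp add: order_trans)
  qed
  have "\<exists>P. finite P \<and> P \<subseteq> X \<and> (\<forall>x\<in>X. \<exists>p\<in>P. dist x p < 1 / real (Suc n))" for n
  proof -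
    have pos: "0 < 1 / real (Suc n)" by simp
    obtain P s where P: "finite P" "P \<subseteq> X" and s: "\<And>t. t \<in> X \<Longrightarrow> s t \<in> P"
      "\<And>t. t \<in> X \<Longrightarrow> dist t (s t) < 1 / real (Suc n)"
      by (rule finite_net[OF pos]) (rule that; assumption)
    then show ?thesis by (intro exI[of _ P]) blast
  qed
  then obtain P where P: "\<And>n. finite (P n)" "\<And>n. P n \<subseteq> X"
    "\<And>n x. x \<in> X \<Longrightarrow> \<exists>p\<in>P n. dist x p < 1 / real (Suc n)" by metis
  define R where "R = (\<Union>n. P n)"
  have R: "countable R" "R \<subseteq> X" using P by (auto simp: R_def countable_finite)
  have R_bound: "norm (T (g n) x) \<le> C" if "x \<in> R" for n x using bound R(2) that by blast
  obtain k where k: "strict_mono (k :: nat \<Rightarrow> nat)"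
    "\<And>x. x \<in> R \<Longrightarrow> \<exists>l. (\<lambda>n. T (g (k n)) x) \<longlonglongrightarrow> l"
    using function_convergent_subsequence[OF R(1), of "\<lambda>n. T (g n)" C] R_bound by blast
  have "convergent (\<lambda>n. T (g (k n)) x)" if x: "x \<in> X" for x
  proof -
    have "Cauchy (\<lambda>n. T (g (k n)) x)"
    proof (rule metric_CauchyI)
      fix e :: real assume "e > 0"
      then have e3: "e / 3 > 0" by simp
      obtain d where d: "d > 0" "\<And>f x y. \<lbrakk>integrable \<nu> f; (\<integral>t. norm (f t) \<partial>\<nu>) \<le> sqrt (measure \<nu> (space \<nu>));
          x \<in> X; y \<in> X; dist x y < d\<rbrakk> \<Longrightarrow> norm (T f x - T f y) < e / 3"
        by (rule T_equicontinuous[OF e3, of "sqrt (measure \<nu> (space \<nu>))"]) (rule that; assumption)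
      obtain j where j: "1 / real (Suc j) < d" using d(1) nat_approx_posE by blast
      obtain p where p: "p \<in> P j" "dist x p < 1 / real (Suc j)" using P(3)[OF x] by blast
      then have pR: "p \<in> R" "p \<in> X" using P(2) by (auto simp: R_def)
      have near: "dist (T (g n) x) (T (g n) p) < e / 3" for n
        unfolding dist_norm using p j by (intro d int L1 x pR) simp
      have "Cauchy (\<lambda>n. T (g (k n)) p)" using k(2)[OF pR(1)] LIMSEQ_imp_Cauchy by blast
      then obtain M where M: "\<And>m n. m \<ge> M \<Longrightarrow> n \<ge> M \<Longrightarrow> dist (T (g (k m)) p) (T (g (k n)) p) < e / 3"
        using \<open>e > 0\<close> metric_CauchyD[of _ "e / 3"] by (metis divide_pos_pos zero_less_numeral)
      have "dist (T (g (k m)) x) (T (g (k n)) x) < e" if "m \<ge> M" "n \<ge> M" for m n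
        using M[OF that] near[of "k m"] near[of "k n"]
          dist_triangle[of "T (g (k m)) x" "T (g (k n)) x" "T (g (k m)) p"]
          dist_triangle[of "T (g (k m)) p" "T (g (k n)) x" "T (g (k n)) p"]
        by (simp add: dist_commute)
      then show "\<exists>M. \<forall>m\<ge>M. \<forall>n\<ge>M. dist (T (g (k m)) x) (T (g (k n)) x) < e" by blast
    qed
    then show ?thesis by (simp add: Cauchy_convergent_iff)
  qed
  then show ?thesis
    using that[OF k(1), of "\<lambda>x. lim (\<lambda>n. T (g (k n)) x)"] by (simp add: convergent_LIMSEQ_iff)
qed

end

section \<open>Uniform convergence\<close>

text \<open>Points at which the bound fails cluster at some \<open>l\<close>. Fix \<open>M\<close>
  with \<open>d M l < e\<close>; by monotonicity \<open>d M\<close> is at least \<open>e\<close>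
  along a tail of the clustering sequence, hence at \<open>l\<close> by continuity.\<close>

lemma Dini_decreasing:
  fixes d :: "nat \<Rightarrow> 'a::metric_space \<Rightarrow> real"
  assumes X: "compact X" and cont: "\<And>n. continuous_on X (d n)"
    and dec: "\<And>m n x. x \<in> X \<Longrightarrow> m \<le> n \<Longrightarrow> d n x \<le> d m x"
    and lim: "\<And>x. x \<in> X \<Longrightarrow> (\<lambda>n. d n x) \<longlonglongrightarrow> 0" and "e > 0"
  shows "\<exists>M. \<forall>m\<ge>M. \<forall>x\<in>X. d m x < e"
proof (rule ccontr)
  assume "\<not> ?thesis"
  \<comment> \<open>A failure at some index beyond \<open>M\<close> is moved back to
    \<open>M\<close> itself by monotonicity.\<close>
  then have "\<forall>M. \<exists>x\<in>X. d M x \<ge> e" using dec by (meson le_less_trans not_le)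
  then obtain x where x: "\<And>M. x M \<in> X" "\<And>M. d M (x M) \<ge> e" by metis
  obtain l r where l: "l \<in> X" "strict_mono (r :: nat \<Rightarrow> nat)" "(x \<circ> r) \<longlonglongrightarrow> l"
    using X x(1) unfolding compact_def by metis
  obtain M where M: "d M l < e"
    using order_tendstoD(2)[OF lim[OF l(1)] \<open>e > 0\<close>] by (auto simp: eventually_sequentially)
  have "(\<lambda>j. d M ((x \<circ> r) j)) \<longlonglongrightarrow> d M l"
    by (rule continuous_on_tendsto_compose[OF cont l(3,1)]) (simp add: x)
  moreover have "\<forall>\<^sub>F j in sequentially. e \<le> d M ((x \<circ> r) j)"
    using eventually_ge_at_top[of M]
  proof eventually_elim
    case (elim j)
    then have "M \<le> r j" using seq_suble[OF l(2), of j] by linarith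
    then show ?case using x(2)[of "r j"] dec[OF x(1)] by (metis comp_apply order_trans)
  qed
  ultimately have "e \<le> d M l" by (intro tendsto_lowerbound) auto
  then show False using M by simp
qed

lemma norm_sum_mult_conjg_le:
  fixes u v :: "'b \<Rightarrow> 'k::real_or_complex"
  shows "norm (\<Sum>n\<in>A. u n * conjg (v n)) \<le> sqrt ((\<Sum>n\<in>A. (norm (u n))\<^sup>2) * (\<Sum>n\<in>A. (norm (v n))\<^sup>2))"
proof -
  have "norm (\<Sum>n\<in>A. u n * conjg (v n)) \<le> (\<Sum>n\<in>A. norm (u n) * norm (v n))"
    by (rule order_trans[OF norm_sum]) (simp add: norm_mult)
  also have "\<dots> \<le> sqrt ((\<Sum>n\<in>A. (norm (u n))\<^sup>2) * (\<Sum>n\<in>A. (norm (v n))\<^sup>2))"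
    using Cauchy_Schwarz_ineq_sum[of "\<lambda>n. norm (u n)" "\<lambda>n. norm (v n)" A] by (rule real_le_rsqrt)
  finally show ?thesis .
qed

text \<open>By Cauchy-Schwarz, uniformly small tails in the first variable and bounded sums in the
  second suffice. \<open>S\<close> is kept general to cover both a single row
  \<open>{x} \<times> X\<close> and the whole square.\<close>

lemma uniform_limit_conjg_series:
  fixes u :: "nat \<Rightarrow> 'a \<Rightarrow> 'k::real_or_complex"
  assumes lim: "\<And>x y. (x, y) \<in> S \<Longrightarrow> (\<lambda>n. u n x * conjg (u n y)) sums B x y"
    and C: "\<And>x y m. (x, y) \<in> S \<Longrightarrow> (\<Sum>n<m. (norm (u n y))\<^sup>2) \<le> C"
    and tail: "\<And>e. e > 0 \<Longrightarrow> \<exists>M. \<forall>m\<ge>M. \<forall>k. \<forall>(x, y)\<in>S. (\<Sum>n\<in>{m..<k}. (norm (u n x))\<^sup>2) < e"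
  shows "uniform_limit S (\<lambda>m (x, y). \<Sum>n<m. u n x * conjg (u n y)) (\<lambda>(x, y). B x y) sequentially"
  unfolding uniform_limit_sequentially_iff
proof (intro allI impI)
  fix e :: real assume "e > 0"
  define D where "D = \<bar>C\<bar> + 1"
  have "D > 0" by (simp add: D_def)
  \<comment> \<open>Chosen so that \<open>sqrt (e' * D) = e / 2\<close>; \<open>D\<close> exceeds
    \<open>C\<close> and is positive, which permits the division.\<close>
  define e' where "e' = (e / 2)\<^sup>2 / D"
  have "e' > 0" using \<open>e > 0\<close> \<open>D > 0\<close> by (simp add: e'_def)
  then obtain M where M: "\<And>m k x y. m \<ge> M \<Longrightarrow> (x, y) \<in> S \<Longrightarrow> (\<Sum>n\<in>{m..<k}. (norm (u n x))\<^sup>2) < e'"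
    using tail[of e'] by fastforce
  have "norm (B x y - (\<Sum>n<m. u n x * conjg (u n y))) \<le> e / 2" if m: "m \<ge> M" and xy: "(x, y) \<in> S" for m x y
  proof (rule Lim_norm_ubound)
    show "(\<lambda>k. (\<Sum>n<k. u n x * conjg (u n y)) - (\<Sum>n<m. u n x * conjg (u n y)))
        \<longlonglongrightarrow> B x y - (\<Sum>n<m. u n x * conjg (u n y))"
      using lim[OF xy] by (intro tendsto_diff tendsto_const) (simp add: sums_def)
    show "\<forall>\<^sub>F k in sequentially.
        norm ((\<Sum>n<k. u n x * conjg (u n y)) - (\<Sum>n<m. u n x * conjg (u n y))) \<le> e / 2"
      using eventually_ge_at_top[of m]
    proof eventually_elim
      case (elim k)
      have "(\<Sum>n<k. u n x * conjg (u n y)) - (\<Sum>n<m. u n x * conjg (u n y))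
          = (\<Sum>n\<in>{m..<k}. u n x * conjg (u n y))"
        using sum_diff_nat_ivl[of 0 m k "\<lambda>n. u n x * conjg (u n y)"] elim by (simp add: atLeast0LessThan)
      also have "norm \<dots> \<le> sqrt ((\<Sum>n\<in>{m..<k}. (norm (u n x))\<^sup>2) * (\<Sum>n\<in>{m..<k}. (norm (u n y))\<^sup>2))"
        by (rule norm_sum_mult_conjg_le)
      also have "\<dots> \<le> sqrt (e' * D)"
      proof (intro real_sqrt_le_mono mult_mono)
        show "(\<Sum>n\<in>{m..<k}. (norm (u n x))\<^sup>2) \<le> e'" using M[OF m xy] by (rule less_imp_le)
        have "(\<Sum>n\<in>{m..<k}. (norm (u n y))\<^sup>2) \<le> (\<Sum>n<k. (norm (u n y))\<^sup>2)"
          by (rule sum_mono2) auto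
        then show "(\<Sum>n\<in>{m..<k}. (norm (u n y))\<^sup>2) \<le> D" using C[OF xy, of k] by (simp add: D_def)
      qed (use \<open>e' > 0\<close> in \<open>auto intro: sum_nonneg\<close>)
      also have "\<dots> = e / 2" using \<open>e > 0\<close> \<open>D > 0\<close> by (simp add: e'_def)
      finally show ?case .
    qed
  qed simp
  then show "\<exists>M. \<forall>m\<ge>M. \<forall>p\<in>S. dist ((\<lambda>(x, y). \<Sum>n<m. u n x * conjg (u n y)) p) ((\<lambda>(x, y). B x y) p) < e"
    using \<open>e > 0\<close> by (intro exI[of _ M]) (force simp: dist_norm norm_minus_commute)
qed

section \<open>Systems of eigenfunctions\<close>

text \<open>\<open>eigenfunction\<close> constrains \<open>\<phi>\<close> almost everywhere only;
  \<open>\<phi>_eq\<close> selects the continuous representative, whose values at every point enter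
  the series.\<close>

locale mercer_system = mercer_setting X K \<nu>
  for X :: "'a::metric_space set" and K :: "'a \<Rightarrow> 'a \<Rightarrow> 'k::real_or_complex" and \<nu> :: "'a measure" +
  fixes N :: enat and ev :: "nat \<Rightarrow> real" and \<phi> :: "nat \<Rightarrow> 'a \<Rightarrow> 'k"
  assumes supp: "kernel_supp X K \<subseteq> measure_supp X \<nu>"
    and eigenvalues: "enumerates_nonzero_eigenvalues \<nu> K N ev"
    and orthonormal: "orthonormal_system \<nu> {n. enat n < N} \<phi>"
    and eigenfunction: "\<And>n. enat n < N \<Longrightarrow> \<phi> n \<in> eigenspace \<nu> K (of_real (ev n))"
    and \<phi>_eq: "\<And>n x. enat n < N \<Longrightarrow> x \<in> X \<Longrightarrow> \<phi> n x = 1 / of_real (ev n) * T (\<phi> n) x"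
begin

lemma ev_pos: "enat n < N \<Longrightarrow> ev n > 0"
  using eigenvalues by (simp add: enumerates_nonzero_eigenvalues_def)

lemma \<phi>_L2: "enat n < N \<Longrightarrow> \<phi> n \<in> L2_fun \<nu>"
  using orthonormal by (simp add: orthonormal_system_def)

lemma \<phi>_inner: "enat m < N \<Longrightarrow> enat n < N \<Longrightarrow> L2_inner \<nu> (\<phi> m) (\<phi> n) = (if m = n then 1 else 0)"
  using orthonormal by (simp add: orthonormal_system_def)

lemma \<phi>_norm: "enat n < N \<Longrightarrow> L2_norm_sq \<nu> (\<phi> n) = 1"
  using \<phi>_inner[of n n] L2_inner_self[of \<nu> "\<phi> n"] by simp

lemma T_\<phi>: "enat n < N \<Longrightarrow> x \<in> X \<Longrightarrow> T (\<phi> n) x = of_real (ev n) * \<phi> n x"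
  using \<phi>_eq[of n x] ev_pos[of n] by simp

lemma continuous_\<phi>:
  assumes "enat n < N"
  shows "continuous_on X (\<phi> n)"
proof -
  have "continuous_on X (\<lambda>x. 1 / of_real (ev n) * T (\<phi> n) x)"
    using assms by (intro continuous_on_mult continuous_on_const continuous_T L2_fun_integrable \<phi>_L2)
  then show ?thesis by (rule continuous_on_eq) (simp only: \<phi>_eq[OF assms, symmetric])
qed

text \<open>For the chosen \<open>f\<close> each of the two linear terms equals \<open>- S\<close>
  and the quadratic term equals \<open>S\<close>, so the form of \<open>psd_integral\<close>
  collapses to \<open>K x x - S\<close>.\<close>

lemma Bessel:
  assumes I: "finite I" "I \<subseteq> {n. enat n < N}" and x: "x \<in> X"
  shows "(\<Sum>n\<in>I. ev n * (norm (\<phi> n x))\<^sup>2) \<le> norm (K x x)"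
proof -
  define S where "S = (\<Sum>n\<in>I. ev n * (norm (\<phi> n x))\<^sup>2)"
  define f where "f = (\<lambda>t. \<Sum>n\<in>I. - conjg (\<phi> n x) * \<phi> n t)"
  have L2: "(\<lambda>t. c * \<phi> n t) \<in> L2_fun \<nu>" if "n \<in> I" for n c
    using that I by (intro L2_fun_cmult \<phi>_L2) auto
  have fL2: "f \<in> L2_fun \<nu>" unfolding f_def by (rule L2_fun_sum[OF L2])
  have Tf: "T f y = (\<Sum>n\<in>I. (- conjg (\<phi> n x) * of_real (ev n)) * \<phi> n y)" if y: "y \<in> X" for y
  proof -
    have "T f y = (\<Sum>n\<in>I. T (\<lambda>t. - conjg (\<phi> n x) * \<phi> n t) y)"
      unfolding f_def by (rule T_sum[OF L2 y])
    also have "\<dots> = (\<Sum>n\<in>I. (- conjg (\<phi> n x) * of_real (ev n)) * \<phi> n y)"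
      unfolding T_cmult using I y by (intro sum.cong refl) (auto simp: T_\<phi>)
    finally show ?thesis .
  qed
  have mc: "conjg z * of_real r * z = of_real (r * (norm z)\<^sup>2)" for z :: 'k and r
    using mult_conjg[of z] by (simp add: mult_ac)
  have Tfx: "T f x = - of_real S"
    unfolding Tf[OF x] S_def of_real_sum by (simp add: sum_negf mc del: of_real_mult)
  have fn: "L2_inner \<nu> f (\<phi> n) = - conjg (\<phi> n x)" if n: "n \<in> I" for n
  proof -
    have "L2_inner \<nu> f (\<phi> n) = (\<Sum>m\<in>I. L2_inner \<nu> (\<lambda>t. - conjg (\<phi> m x) * \<phi> m t) (\<phi> n))"
      unfolding f_def using n I by (intro L2_inner_sum_left[OF L2] \<phi>_L2) auto
    also have "\<dots> = (\<Sum>m\<in>I. if m = n then - conjg (\<phi> m x) else 0)"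
      unfolding L2_inner_cmult_left using n I by (intro sum.cong refl) (auto simp: \<phi>_inner subset_eq)
    finally show ?thesis using n I by simp
  qed
  have "L2_inner \<nu> (T f) f = L2_inner \<nu> (\<lambda>y. \<Sum>n\<in>I. (- conjg (\<phi> n x) * of_real (ev n)) * \<phi> n y) f"
    by (rule L2_inner_cong) (rule Tf)
  also have "\<dots> = (\<Sum>n\<in>I. (- conjg (\<phi> n x) * of_real (ev n)) * L2_inner \<nu> (\<phi> n) f)"
    by (subst L2_inner_sum_left[OF L2 fL2]) (simp_all only: L2_inner_cmult_left)
  also have "\<dots> = (\<Sum>n\<in>I. (- conjg (\<phi> n x) * of_real (ev n)) * - \<phi> n x)"
    by (intro sum.cong refl) (simp add: L2_inner_commute[of \<nu> _ f] fn conjg_minus)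
  also have "\<dots> = of_real S"
    unfolding S_def of_real_sum by (simp add: mc del: of_real_mult)
  finally have inner: "L2_inner \<nu> (T f) f = of_real S" .
  have "K x x + T f x + conjg (T f x) + L2_inner \<nu> (T f) f \<in> \<real>\<^sub>\<ge>\<^sub>0"
    by (rule psd_integral[OF x L2_fun_integrable[OF fL2]])
  also have "K x x + T f x + conjg (T f x) + L2_inner \<nu> (T f) f = of_real (norm (K x x) - S)"
    unfolding inner Tfx conjg_minus conjg_of_real by (subst K_diag[OF x]) simp
  finally show ?thesis by (simp only: nonneg_Reals_of_real_iff S_def)
qed

text \<open>Integrating Bessel's inequality over the diagonal bounds the trace.\<close>

lemma sum_ev_le:
  obtains D where "\<And>I. finite I \<Longrightarrow> I \<subseteq> {n. enat n < N} \<Longrightarrow> (\<Sum>n\<in>I. ev n) \<le> D"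
proof -
  obtain C where C: "\<And>x y. x \<in> X \<Longrightarrow> y \<in> X \<Longrightarrow> norm (K x y) \<le> C" using K_bounded by metis
  show ?thesis
  proof (rule that)
    fix I assume I: "finite I" "I \<subseteq> {n. enat n < N}"
    have int: "integrable \<nu> (\<lambda>x. (norm (\<phi> n x))\<^sup>2)" if "n \<in> I" for n
      using \<phi>_L2[of n] that I by (auto simp: L2_fun_def)
    have "(\<Sum>n\<in>I. ev n) = (\<Sum>n\<in>I. ev n * L2_norm_sq \<nu> (\<phi> n))"
      using I by (intro sum.cong) (auto simp: \<phi>_norm)
    also have "\<dots> = (\<integral>x. (\<Sum>n\<in>I. ev n * (norm (\<phi> n x))\<^sup>2) \<partial>\<nu>)"
      unfolding L2_norm_sq_def using int by simp
    also have "\<dots> \<le> (\<integral>x. C \<partial>\<nu>)"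
    proof (rule integral_mono)
      show "integrable \<nu> (\<lambda>x. \<Sum>n\<in>I. ev n * (norm (\<phi> n x))\<^sup>2)" using int by simp
      show "(\<Sum>n\<in>I. ev n * (norm (\<phi> n x))\<^sup>2) \<le> C" if "x \<in> space \<nu>" for x
        using Bessel[OF I] C that by (force simp: space_\<nu>)
    qed simp
    finally show "(\<Sum>n\<in>I. ev n) \<le> (\<integral>x. C \<partial>\<nu>)" .
  qed
qed

text \<open>Infinitely many copies of one positive eigenvalue would exceed the trace bound.
  Finiteness matters because one more independent eigenfunction contradicts a multiplicity only if
  that multiplicity is finite.\<close>

lemma finite_multiplicity:
  assumes "c \<noteq> (0::'k)"
  shows "finite {n. enat n < N \<and> of_real (ev n) = c}"
proof (rule ccontr)
  assume inf: "infinite {n. enat n < N \<and> of_real (ev n) = c}" (is "infinite ?S")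
  then obtain n0 where n0: "n0 \<in> ?S" using not_finite_existsD by blast
  define l where "l = ev n0"
  have "l > 0" using ev_pos n0 by (simp add: l_def)
  have l: "ev n = l" if "n \<in> ?S" for n
  proof -
    have "(of_real (ev n) :: 'k) = of_real l" using that n0 by (simp add: l_def)
    then show ?thesis by simp
  qed
  obtain D where D: "\<And>I. finite I \<Longrightarrow> I \<subseteq> {n. enat n < N} \<Longrightarrow> (\<Sum>n\<in>I. ev n) \<le> D"
    using sum_ev_le by metis
  obtain k :: nat where k: "D / l < real k" using reals_Archimedean2 by blast
  obtain I where I: "finite I" "card I = k" "I \<subseteq> ?S" using infinite_arbitrarily_large[OF inf] by metis
  have "(\<Sum>n\<in>I. ev n) = (\<Sum>n\<in>I. l)" 
    by (rule sum.cong[OF refl l[OF subsetD[OF I(3)]]])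
  then have "(\<Sum>n\<in>I. ev n) = real k * l" using I(2) by simp
  moreover have "(\<Sum>n\<in>I. ev n) \<le> D" using I by (intro D) auto
  ultimately show False using k \<open>l > 0\<close> by (simp add: field_simps)
qed

text \<open>If \<open>g\<close> were nonzero, then together with the \<open>m\<close> functions
  \<open>\<phi> n\<close> belonging to \<open>c\<close> it would give \<open>m + 1\<close>
  orthogonal nonzero elements of an eigenspace of dimension \<open>m\<close>. For \<open>c\<close>
  not among the listed eigenvalues, in particular for negative \<open>c\<close>, this is the case
  \<open>m = 0\<close>.\<close>

lemma orthogonal_eigenfunction_zero:
  assumes c: "c \<noteq> 0" and g: "g \<in> eigenspace \<nu> K c"
    and orth: "\<And>n. enat n < N \<Longrightarrow> L2_inner \<nu> g (\<phi> n) = 0"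
  shows "L2_norm_sq \<nu> g = 0"
proof (rule ccontr)
  assume nz: "L2_norm_sq \<nu> g \<noteq> 0"
  define S where "S = {n. enat n < N \<and> of_real (ev n) = c}"
  define m where "m = card S"
  have fin: "finite S" unfolding S_def by (rule finite_multiplicity[OF c])
  have mult: "eigen_multiplicity \<nu> K c = enat m"
    using eigenvalues c fin by (auto simp: enumerates_nonzero_eigenvalues_def ecard_def S_def m_def)
  obtain b where b: "bij_betw b {..<m} S"
    using ex_bij_betw_nat_finite[OF fin] by (auto simp: atLeast0LessThan m_def)
  have bS: "enat (b i) < N" "of_real (ev (b i)) = c" if "i < m" for i
    using b that by (auto simp: bij_betw_def S_def)
  have b_inj: "b i = b j \<longleftrightarrow> i = j" if "i < m" "j < m" for i j
    using b that by (auto simp: bij_betw_def inj_on_def)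
  define F where "F i = (if i < m then \<phi> (b i) else g)" for i
  have F_eig: "F i \<in> eigenspace \<nu> K c" for i
    using eigenfunction bS g by (auto simp: F_def)
  then have F_L2: "F i \<in> L2_fun \<nu>" for i by (simp add: eigenspace_def)
  have F_orth: "L2_inner \<nu> (F i) (F j) = 0" if "i \<noteq> j" "i < Suc m" "j < Suc m" for i j
    using that bS b_inj orth L2_inner_commute[of \<nu> "\<phi> (b i)" g]
    by (auto simp: F_def \<phi>_inner)
  have F_nz: "L2_inner \<nu> (F i) (F i) \<noteq> 0" for i
    using nz bS by (auto simp: F_def L2_inner_self \<phi>_norm)
  have "L2_independent \<nu> (Suc m) F"
    unfolding L2_independent_def
  proof (intro allI impI)
    fix a :: "nat \<Rightarrow> 'k" and j assume ae: "AE x in \<nu>. (\<Sum>i<Suc m. a i * F i x) = 0" and j: "j < Suc m"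
    have aL2: "(\<lambda>x. a i * F i x) \<in> L2_fun \<nu>" for i by (rule L2_fun_cmult[OF F_L2])
    have "0 = L2_inner \<nu> (\<lambda>x. \<Sum>i<Suc m. a i * F i x) (F j)"
      using L2_inner_AE_cong[OF ae L2_fun_measurable L2_fun_measurable L2_fun_measurable, of "F j"]
        L2_fun_sum[of "{..<Suc m}" "\<lambda>i x. a i * F i x" \<nu>] aL2 F_L2 L2_fun_cmult[OF F_L2, of 0 j]
      by (simp add: L2_inner_def)
    also have "\<dots> = (\<Sum>i<Suc m. a i * L2_inner \<nu> (F i) (F j))"
      by (subst L2_inner_sum_left[OF aL2 F_L2]) (simp only: L2_inner_cmult_left)
    also have "\<dots> = (\<Sum>i<Suc m. if i = j then a j * L2_inner \<nu> (F j) (F j) else 0)"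
      using j by (intro sum.cong refl) (auto simp: F_orth)
    also have "\<dots> = a j * L2_inner \<nu> (F j) (F j)" using j by simp
    finally show "a j = 0" using F_nz[of j] by simp
  qed
  then have "enat (Suc m) \<le> eigen_multiplicity \<nu> K c"
    unfolding eigen_multiplicity_def using F_eig by (intro Sup_upper) blast
  then show False by (simp add: mult)
qed

section \<open>The operator on the orthogonal complement of the eigenfunctions\<close>

definition orthocomp :: "('a \<Rightarrow> 'k) set" where
  "orthocomp = {g \<in> L2_fun \<nu>. \<forall>n. enat n < N \<longrightarrow> L2_inner \<nu> g (\<phi> n) = 0}"

lemma orthocomp_L2: "g \<in> orthocomp \<Longrightarrow> g \<in> L2_fun \<nu>"
  by (simp add: orthocomp_def)

lemma orthocomp_cmult: "g \<in> orthocomp \<Longrightarrow> (\<lambda>x. c * g x) \<in> orthocomp"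
  by (simp add: orthocomp_def L2_fun_cmult L2_inner_cmult_left)

lemma orthocomp_diff: "f \<in> orthocomp \<Longrightarrow> g \<in> orthocomp \<Longrightarrow> (\<lambda>x. f x - g x) \<in> orthocomp"
  by (simp add: orthocomp_def L2_fun_diff L2_inner_diff_left \<phi>_L2)

lemma L2_inner_T_\<phi>:
  assumes "g \<in> L2_fun \<nu>" "enat n < N"
  shows "L2_inner \<nu> (T g) (\<phi> n) = of_real (ev n) * L2_inner \<nu> g (\<phi> n)"
proof -
  have "L2_inner \<nu> (T g) (\<phi> n) = conjg (L2_inner \<nu> (T (\<phi> n)) g)"
    using T_self_adjoint[of g "\<phi> n"] assms \<phi>_L2 L2_inner_commute by metis
  also have "L2_inner \<nu> (T (\<phi> n)) g = of_real (ev n) * L2_inner \<nu> (\<phi> n) g"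
    using L2_inner_cong[OF T_\<phi>[OF assms(2)], where g = g] by (simp add: L2_inner_cmult_left)
  finally show ?thesis by (simp add: conjg_of_real flip: L2_inner_commute)
qed

lemma T_orthocomp: "g \<in> orthocomp \<Longrightarrow> T g \<in> orthocomp"
  by (simp add: orthocomp_def T_L2 L2_inner_T_\<phi>)

text \<open>
  An extremal sequence for \<open>M = \<parallel>T\<parallel>\<^sup>2\<close> on \<open>orthocomp\<close> yields a limit \<open>h \<noteq> 0\<close> with
  \<open>T (T h) = M h\<close>, because \<open>\<parallel>T (T g) - M g\<parallel>\<^sup>2 \<le> M (M - \<parallel>T g\<parallel>\<^sup>2)\<close> for \<open>g\<close> in the unit ball;
  then \<open>h\<close> or \<open>T h - \<surd>M h\<close> is an eigenfunction orthogonal to the system.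
\<close>

lemma T_norm_orthocomp:
  assumes g0: "g0 \<in> orthocomp"
  shows "L2_norm_sq \<nu> (T g0) = 0"
proof (rule ccontr)
  assume nz: "L2_norm_sq \<nu> (T g0) \<noteq> 0"
  obtain C where C: "C > 0"
    "\<And>f x. f \<in> L2_fun \<nu> \<Longrightarrow> x \<in> X \<Longrightarrow> norm (T f x) \<le> C * sqrt (L2_norm_sq \<nu> f)"
    using T_bounded_L2 by metis
  have bound: "norm (T f x) \<le> C" if "f \<in> L2_fun \<nu>" "L2_norm_sq \<nu> f \<le> 1" "x \<in> X" for f x
  proof -
    have "C * sqrt (L2_norm_sq \<nu> f) \<le> C * 1"
      using C(1) that by (intro mult_left_mono) auto
    then show ?thesis using C(2)[OF that(1,3)] by linarith
  qed
  define U where "U = {g \<in> orthocomp. L2_norm_sq \<nu> g \<le> 1}"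
  define M where "M = (SUP g\<in>U. L2_norm_sq \<nu> (T g))"
  have bdd: "bdd_above ((\<lambda>g. L2_norm_sq \<nu> (T g)) ` U)"
  proof (rule bdd_aboveI2)
    fix g assume g: "g \<in> U"
    show "L2_norm_sq \<nu> (T g) \<le> (\<integral>x. C\<^sup>2 \<partial>\<nu>)"
      unfolding L2_norm_sq_def
    proof (rule integral_mono)
      show "integrable \<nu> (\<lambda>x. (norm (T g x))\<^sup>2)"
        using g T_L2[OF orthocomp_L2] by (auto simp: U_def L2_fun_def)
      show "(norm (T g x))\<^sup>2 \<le> C\<^sup>2" if "x \<in> space \<nu>" for x
        using g that bound orthocomp_L2 by (intro power_mono) (auto simp: U_def space_\<nu>)
    qed simp
  qed
  \<comment> \<open>Homogeneity extends the bound beyond the unit ball. A function of norm zero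
    cannot be normalised; there the sup-norm estimate makes \<open>T g\<close> vanish on
    \<open>X\<close>.\<close>
  have le_M: "L2_norm_sq \<nu> (T g) \<le> M * L2_norm_sq \<nu> g" if g: "g \<in> orthocomp" for g
  proof (cases "L2_norm_sq \<nu> g = 0")
    case True
    then have "T g x = 0" if "x \<in> X" for x using C(2)[OF orthocomp_L2[OF g] that] by simp
    then have "L2_norm_sq \<nu> (T g) = (\<integral>x. 0 \<partial>\<nu>)"
      unfolding L2_norm_sq_def by (intro Bochner_Integration.integral_cong) (auto simp: space_\<nu>)
    then show ?thesis using True by simp
  next
    case False
    define r where "r = sqrt (L2_norm_sq \<nu> g)"
    have r: "r > 0" "r\<^sup>2 = L2_norm_sq \<nu> g"
      using False L2_norm_sq_nonneg[of \<nu> g] by (auto simp: r_def simp del: L2_norm_sq_nonneg)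
    define g1 where "g1 = (\<lambda>x. of_real (1 / r) * g x)"
    have n1: "L2_norm_sq \<nu> g1 = 1"
      unfolding g1_def L2_norm_sq_cmult using r False by (simp add: power_divide norm_divide)
    have "g1 \<in> orthocomp" unfolding g1_def by (rule orthocomp_cmult[OF g])
    then have "g1 \<in> U" using n1 by (simp add: U_def)
    then have "L2_norm_sq \<nu> (T g1) \<le> M" unfolding M_def by (intro cSUP_upper bdd)
    moreover have "T g1 = (\<lambda>x. of_real (1 / r) * T g x)"
      unfolding g1_def by (rule ext) (rule T_cmult)
    then have "L2_norm_sq \<nu> (T g1) = L2_norm_sq \<nu> (T g) / r\<^sup>2"
      unfolding L2_norm_sq_cmult[symmetric] using L2_norm_sq_cmult[of \<nu> "of_real (1 / r)" "T g"] r
      by (simp add: power_divide norm_divide)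
    moreover have "L2_norm_sq \<nu> g > 0" using r by (metis zero_less_power)
    ultimately show ?thesis using r by (simp add: divide_le_eq)
  qed
  have "M > 0"
  proof (rule ccontr)
    assume "\<not> M > 0"
    then have "M * L2_norm_sq \<nu> g0 \<le> 0" by (simp add: mult_nonpos_nonneg)
    then show False using le_M[OF g0] nz L2_norm_sq_nonneg[of \<nu> "T g0"] by linarith
  qed
  have "\<exists>g\<in>U. L2_norm_sq \<nu> (T g) > M - 1 / real (Suc n)" for n
  proof -
    \<comment> \<open>The zero function, written as a multiple of \<open>g0\<close> to inherit
      membership in \<open>orthocomp\<close>, shows that \<open>U\<close> is nonempty.\<close>
    have "(\<lambda>x. 0 * g0 x) \<in> U"
      using orthocomp_cmult[OF g0, of 0] L2_norm_sq_cmult[of \<nu> 0 g0] by (simp add: U_def)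
    then have "U \<noteq> {}" by blast
    moreover have "M - 1 / real (Suc n) < (SUP g\<in>U. L2_norm_sq \<nu> (T g))"
      unfolding M_def[symmetric] by simp
    ultimately show ?thesis using less_cSUP_iff[OF _ bdd, of "M - 1 / real (Suc n)"] by simp
  qed
  then obtain g where gU: "\<And>n. g n \<in> U" and g_M: "\<And>n. L2_norm_sq \<nu> (T (g n)) > M - 1 / real (Suc n)"
    by metis
  have g: "g n \<in> orthocomp" "g n \<in> L2_fun \<nu>" "L2_norm_sq \<nu> (g n) \<le> 1" for n
    using gU[of n] orthocomp_L2 by (auto simp: U_def)
  obtain k h where k: "strict_mono (k :: nat \<Rightarrow> nat)"
    and h: "\<And>x. x \<in> X \<Longrightarrow> (\<lambda>n. T (g (k n)) x) \<longlonglongrightarrow> h x"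
    by (rule T_compact[of g, OF g(2,3)]) (rule that; assumption)
  define F where "F n = T (g (k n))" for n
  have F_lim: "(\<lambda>n. F n x) \<longlonglongrightarrow> h x" if "x \<in> X" for x using h[OF that] by (simp add: F_def)
  have F_W: "F n \<in> orthocomp" and F_bound: "x \<in> X \<Longrightarrow> norm (F n x) \<le> C" for n x
    unfolding F_def using T_orthocomp g bound by auto
  have F_meas[measurable]: "F n \<in> borel_measurable \<nu>" for n using F_W orthocomp_L2 L2_fun_measurable by blast
  have h_meas[measurable]: "h \<in> borel_measurable \<nu>"
    by (rule borel_measurable_LIMSEQ_metric[of F]) (simp_all add: space_\<nu> F_lim)
  have h_bound: "norm (h x) \<le> C" if "x \<in> X" for x
    using F_bound[OF that] by (intro Lim_norm_ubound[OF _ F_lim[OF that]]) auto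
  have h_L2: "h \<in> L2_fun \<nu>" using h_bound by (intro L2_fun_bounded[where B = C]) (auto simp: space_\<nu>)
  \<comment> \<open>Weak convergence, which carries orthogonality to the \<open>\<phi> i\<close>
    over to the limit.\<close>
  have F_inner: "(\<lambda>n. L2_inner \<nu> (F n) w) \<longlonglongrightarrow> L2_inner \<nu> h w" if w: "w \<in> L2_fun \<nu>" for w
    unfolding L2_inner_def
    by (rule bounded_convergence[OF L2_fun_integrable[OF L2_fun_conjg[OF w]] F_meas h_meas F_bound F_lim])
  have h_W: "h \<in> orthocomp"
  proof -
    have "L2_inner \<nu> h (\<phi> i) = 0" if i: "enat i < N" for i
    proof -
      have "(\<lambda>n. L2_inner \<nu> (F n) (\<phi> i)) = (\<lambda>n. 0)" using F_W i by (auto simp: orthocomp_def)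
      then show ?thesis using F_inner[OF \<phi>_L2[OF i]] LIMSEQ_unique[OF tendsto_const] by metis
    qed
    then show ?thesis using h_L2 by (simp add: orthocomp_def)
  qed
  have T_lim: "(\<lambda>n. T (G n) x) \<longlonglongrightarrow> T G' x"
    if "\<And>n. G n \<in> borel_measurable \<nu>" "G' \<in> borel_measurable \<nu>" "\<And>n t. t \<in> X \<Longrightarrow> norm (G n t) \<le> B"
      "\<And>t. t \<in> X \<Longrightarrow> (\<lambda>n. G n t) \<longlonglongrightarrow> G' t" "x \<in> X" for G G' B x
  proof -
    have "integrable \<nu> (K x)"
      using continuous_K_section that(5) L2_fun_continuous L2_fun_integrable by blast
    from bounded_convergence[OF this that(1-4)] show ?thesis
      by (simp add: integral_op_def mult.commute)
  qed
  have TF_lim: "(\<lambda>n. T (F n) x) \<longlonglongrightarrow> T h x" if "x \<in> X" for x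
    by (rule T_lim[OF F_meas h_meas F_bound F_lim that])
  \<comment> \<open>A second use of \<open>T_lim\<close>, which calls for a bound on
    \<open>T (F n)\<close> uniform in \<open>n\<close>; the uniform bound on \<open>F n\<close>
    supplies it.\<close>
  have TTF_lim: "(\<lambda>n. T (T (F n)) x) \<longlonglongrightarrow> T (T h) x" if x: "x \<in> X" for x
  proof -
    obtain C1 where C1: "C1 > 0"
      "\<And>f x. integrable \<nu> f \<Longrightarrow> x \<in> X \<Longrightarrow> norm (T f x) \<le> C1 * (\<integral>t. norm (f t) \<partial>\<nu>)"
      using T_bounded by metis
    have F_int: "integrable \<nu> (F n)" for n using F_W orthocomp_L2 L2_fun_integrable by blast
    have "norm (T (F n) y) \<le> C1 * (\<integral>t. C \<partial>\<nu>)" if "y \<in> X" for n y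
    proof -
      have "(\<integral>t. norm (F n t) \<partial>\<nu>) \<le> (\<integral>t. C \<partial>\<nu>)"
        using F_int F_bound by (intro integral_mono) (auto simp: space_\<nu>)
      then show ?thesis using C1(2)[OF F_int that] C1(1) by (meson order_trans mult_left_mono less_imp_le)
    qed
    from T_lim[OF measurable_T[OF F_int] measurable_T[OF L2_fun_integrable[OF h_L2]] this TF_lim x]
    show ?thesis .
  qed
  define d where "d n = (\<lambda>x. T (F n) x - of_real M * g (k n) x)" for n
  have d_norm: "L2_norm_sq \<nu> (d n) \<le> M * (1 / real (Suc (k n)))" for n
  proof -
    let ?g = "g (k n)"
    have L2: "T (F n) \<in> L2_fun \<nu>" "F n \<in> L2_fun \<nu>" "(\<lambda>x. of_real M * ?g x) \<in> L2_fun \<nu>"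
      using F_W[of n] g T_L2 orthocomp_L2 L2_fun_cmult by blast+
    have TF: "L2_inner \<nu> (T (F n)) ?g = of_real (L2_norm_sq \<nu> (F n))"
      using T_self_adjoint[OF L2(2) g(2)] by (simp add: F_def L2_inner_self)
    have FT: "L2_inner \<nu> ?g (T (F n)) = of_real (L2_norm_sq \<nu> (F n))"
      using TF L2_inner_commute[of \<nu> ?g "T (F n)"] by (simp add: conjg_of_real)
    have "of_real (L2_norm_sq \<nu> (d n)) = L2_inner \<nu> (d n) (d n)" by (simp add: L2_inner_self)
    also have "\<dots> = L2_inner \<nu> (T (F n)) (T (F n)) - of_real M * L2_inner \<nu> (T (F n)) ?g
        - (of_real M * L2_inner \<nu> ?g (T (F n)) - of_real M * (of_real M * L2_inner \<nu> ?g ?g))"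
      unfolding d_def using L2 g(2)[of "k n"]
      by (simp add: L2_inner_diff_left L2_inner_diff_right L2_fun_diff L2_inner_cmult_left
          L2_inner_cmult_right conjg_of_real right_diff_distrib)
    also have "\<dots> = of_real (L2_norm_sq \<nu> (T (F n)) - 2 * M * L2_norm_sq \<nu> (F n) + M\<^sup>2 * L2_norm_sq \<nu> ?g)"
      unfolding TF FT L2_inner_self by (simp add: power2_eq_square algebra_simps)
    finally have "L2_norm_sq \<nu> (d n) = L2_norm_sq \<nu> (T (F n)) - 2 * M * L2_norm_sq \<nu> (F n) + M\<^sup>2 * L2_norm_sq \<nu> ?g"
      by (simp only: of_real_eq_iff)
    \<comment> \<open>\<open>le_M\<close> applies to \<open>F n\<close> because \<open>T\<close>
      preserves \<open>orthocomp\<close>; the last summand uses that \<open>g (k n)\<close> lies in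
      the unit ball.\<close>
    also have "\<dots> \<le> M * L2_norm_sq \<nu> (F n) - 2 * M * L2_norm_sq \<nu> (F n) + M\<^sup>2 * 1"
      using le_M[OF F_W, of n] g(3) \<open>M > 0\<close> by (intro add_mono diff_mono mult_left_mono) auto
    also have "\<dots> = M * (M - L2_norm_sq \<nu> (F n))" by (simp add: power2_eq_square algebra_simps)
    also have "\<dots> \<le> M * (1 / real (Suc (k n)))"
      using g_M[of "k n"] \<open>M > 0\<close> unfolding F_def by (intro mult_left_mono) auto
    finally show ?thesis .
  qed
  have inv_lim: "(\<lambda>n. 1 / real (Suc (k n))) \<longlonglongrightarrow> 0"
    using LIMSEQ_subseq_LIMSEQ[OF LIMSEQ_inverse_real_of_nat k] by (simp add: o_def divide_inverse)
  \<comment> \<open>\<open>d n\<close> contains \<open>g (k n)\<close>, for which no limit is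
    available. One more application of \<open>T\<close> turns it into \<open>F n\<close>, which
    tends to \<open>h\<close>, while the L^2 bound on \<open>d n\<close> forces
    \<open>T (d n)\<close> to zero at every point.\<close>
  have TTh: "T (T h) x = of_real M * h x" if x: "x \<in> X" for x
  proof -
    have "(\<lambda>n. T (d n) x) \<longlonglongrightarrow> 0"
    proof (rule Lim_null_comparison)
      have "norm (T (d n) x) \<le> C * sqrt (M * (1 / real (Suc (k n))))" for n
      proof -
        have "d n \<in> L2_fun \<nu>"
          unfolding d_def using F_W[of n] g orthocomp_L2 T_L2 by (intro L2_fun_diff L2_fun_cmult) auto
        then have "norm (T (d n) x) \<le> C * sqrt (L2_norm_sq \<nu> (d n))" using C x by blast
        also have "\<dots> \<le> C * sqrt (M * (1 / real (Suc (k n))))"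
          using C(1) d_norm by (intro mult_left_mono) auto
        finally show ?thesis .
      qed
      then show "\<forall>\<^sub>F n in sequentially. norm (T (d n) x) \<le> C * sqrt (M * (1 / real (Suc (k n))))"
        by simp
      have "(\<lambda>n. C * sqrt (M * (1 / real (Suc (k n))))) \<longlonglongrightarrow> C * sqrt (M * 0)"
        by (intro tendsto_intros inv_lim)
      then show "(\<lambda>n. C * sqrt (M * (1 / real (Suc (k n))))) \<longlonglongrightarrow> 0" by simp
    qed
    moreover have "T (d n) x = T (T (F n)) x - of_real M * F n x" for n
      unfolding d_def using F_W[of n] g orthocomp_L2 T_L2 x
      by (subst T_diff) (auto simp: L2_fun_cmult T_cmult F_def)
    ultimately have "(\<lambda>n. T (T (F n)) x - of_real M * F n x) \<longlonglongrightarrow> 0" by simp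
    moreover have "(\<lambda>n. T (T (F n)) x - of_real M * F n x) \<longlonglongrightarrow> T (T h) x - of_real M * h x"
      by (intro tendsto_diff tendsto_mult_left TTF_lim F_lim x)
    ultimately have "T (T h) x - of_real M * h x = 0" using LIMSEQ_unique by blast
    then show ?thesis by simp
  qed
  \<comment> \<open>The squared norms of \<open>F n\<close> converge by domination, so
    near-maximality passes to \<open>h\<close>.\<close>
  have h_nz: "L2_norm_sq \<nu> h > 0"
  proof -
    have "(\<lambda>n. L2_norm_sq \<nu> (F n)) \<longlonglongrightarrow> L2_norm_sq \<nu> h"
      unfolding L2_norm_sq_def
    proof (rule integral_dominated_convergence[where w = "\<lambda>_. C\<^sup>2"])
      show "AE x in \<nu>. (\<lambda>n. (norm (F n x))\<^sup>2) \<longlonglongrightarrow> (norm (h x))\<^sup>2"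
        by (rule AE_I2) (auto intro!: tendsto_intros F_lim simp: space_\<nu>)
      show "AE x in \<nu>. norm ((norm (F n x))\<^sup>2) \<le> C\<^sup>2" for n
        by (rule AE_I2) (auto simp: space_\<nu> intro!: power_mono F_bound)
    qed auto
    moreover have "(\<lambda>n. M - 1 / real (Suc (k n))) \<longlonglongrightarrow> M - 0"
      by (intro tendsto_diff tendsto_const inv_lim)
    moreover have "\<forall>n. M - 1 / real (Suc (k n)) \<le> L2_norm_sq \<nu> (F n)"
      unfolding F_def using g_M less_imp_le by blast
    ultimately have "M - 0 \<le> L2_norm_sq \<nu> h" by (intro LIMSEQ_le) auto
    then show ?thesis using \<open>M > 0\<close> by simp
  qed
  define s :: 'k where "s = of_real (sqrt M)"
  have s: "s \<noteq> 0" "s * s = of_real M" using \<open>M > 0\<close> by (auto simp: s_def simp flip: of_real_mult)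
  \<comment> \<open>On \<open>h\<close> the operator \<open>T T - M = (T + s) (T - s)\<close>
    vanishes, so \<open>f\<close> lies in the eigenspace of \<open>- s\<close>; once
    \<open>f\<close> vanishes almost everywhere, \<open>h\<close> lies in that of
    \<open>s\<close>.\<close>
  define f where "f = (\<lambda>x. T h x - s * h x)"
  have f_W: "f \<in> orthocomp" unfolding f_def by (intro orthocomp_diff orthocomp_cmult T_orthocomp h_W)
  have f_0: "L2_norm_sq \<nu> f = 0"
  proof (rule orthogonal_eigenfunction_zero)
    have "T f x = - s * f x" if x: "x \<in> X" for x
      unfolding f_def using h_L2 T_L2 x s(2) TTh[OF x]
      by (subst T_diff) (auto simp: L2_fun_cmult T_cmult algebra_simps simp flip: mult.assoc)
    then show "f \<in> eigenspace \<nu> K (- s)"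
      using f_W orthocomp_L2 by (auto simp: eigenspace_def space_\<nu> intro!: AE_I2)
  qed (use s f_W in \<open>auto simp: orthocomp_def\<close>)
  have "L2_norm_sq \<nu> h = 0"
  proof (rule orthogonal_eigenfunction_zero)
    show "h \<in> eigenspace \<nu> K s"
      using f_0 L2_norm_sq_eq_0_iff[OF orthocomp_L2[OF f_W]] h_L2 by (simp add: eigenspace_def f_def)
  qed (use s h_W in \<open>auto simp: orthocomp_def\<close>)
  then show False using h_nz by simp
qed

lemma zero_outside_kernel_supp:
  assumes "x \<in> X" "x \<notin> kernel_supp X K"
  shows "T g x = 0"
proof -
  have "T g x = (\<integral>t. 0 \<partial>\<nu>)"
    unfolding integral_op_def using assms
    by (intro Bochner_Integration.integral_cong) (auto simp: space_\<nu> kernel_supp_def)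
  then show ?thesis by simp
qed

text \<open>Zero norm only gives vanishing almost everywhere. On \<open>kernel_supp\<close>
  continuity and the support condition upgrade this; off it the row of \<open>K\<close> at
  \<open>x\<close> is zero on \<open>X\<close>.\<close>

lemma T_zero_orthocomp:
  assumes g: "g \<in> orthocomp" and x: "x \<in> X"
  shows "T g x = 0"
proof (cases "x \<in> kernel_supp X K")
  case True
  have "AE t in \<nu>. T g t = 0"
    using T_norm_orthocomp[OF g] L2_norm_sq_eq_0_iff[OF T_L2[OF orthocomp_L2[OF g]]] by simp
  then show ?thesis
    using zero_on_measure_supp[OF continuous_T[OF L2_fun_integrable[OF orthocomp_L2[OF g]]]] True supp by blast
qed (use zero_outside_kernel_supp x in blast)

section \<open>The Mercer series\<close>

text \<open>Absorbing the square root of the eigenvalue makes each term of the series a product to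
  which Cauchy-Schwarz applies; the extension by zero treats finite and infinite \<open>N\<close>
  alike.\<close>

definition \<psi> :: "nat \<Rightarrow> 'a \<Rightarrow> 'k" where
  "\<psi> n x = (if enat n < N then of_real (sqrt (ev n)) * \<phi> n x else 0)"

lemma \<psi>_norm: "(norm (\<psi> n x))\<^sup>2 = (if enat n < N then ev n * (norm (\<phi> n x))\<^sup>2 else 0)"
  using ev_pos[of n] by (auto simp: \<psi>_def norm_mult power_mult_distrib)

lemma mercer_term_eq: "mercer_term N ev \<phi> n x y = \<psi> n x * conjg (\<psi> n y)"
proof (cases "enat n < N")
  case True
  have sq: "of_real (sqrt (ev n)) * of_real (sqrt (ev n)) = (of_real (ev n) :: 'k)"
    using ev_pos[OF True] by (simp flip: of_real_mult)
  then show ?thesis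
    using True unfolding mercer_term_def \<psi>_def sq[symmetric] by (simp add: conjg_of_real mult_ac)
qed (simp add: mercer_term_def \<psi>_def)

lemma continuous_\<psi>: "continuous_on X (\<psi> n)"
  by (cases "enat n < N") (auto simp: \<psi>_def intro!: continuous_intros continuous_\<phi>)

lemma \<psi>_L2: "\<psi> n \<in> L2_fun \<nu>"
  by (rule L2_fun_continuous[OF continuous_\<psi>])

lemma \<psi>_outside: "x \<in> X \<Longrightarrow> x \<notin> kernel_supp X K \<Longrightarrow> \<psi> n x = 0"
  using \<phi>_eq zero_outside_kernel_supp by (simp add: \<psi>_def)

lemma \<psi>_Bessel:
  assumes "x \<in> X"
  shows "(\<Sum>n<m. (norm (\<psi> n x))\<^sup>2) \<le> norm (K x x)"
proof -
  have "(\<Sum>n<m. (norm (\<psi> n x))\<^sup>2) = (\<Sum>n\<in>{n. n < m \<and> enat n < N}. ev n * (norm (\<phi> n x))\<^sup>2)"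
    unfolding \<psi>_norm by (intro sum.mono_neutral_cong_right) auto
  also have "\<dots> \<le> norm (K x x)" using assms by (intro Bessel) auto
  finally show ?thesis .
qed

lemma summable_\<psi>: "x \<in> X \<Longrightarrow> summable (\<lambda>n. (norm (\<psi> n x))\<^sup>2)"
  using \<psi>_Bessel by (intro summableI_nonneg_bounded[where x = "norm (K x x)"]) auto

lemma norm_\<psi>_mult_le: "norm (\<psi> n x * conjg (\<psi> n y)) \<le> (norm (\<psi> n x))\<^sup>2 + (norm (\<psi> n y))\<^sup>2"
  using sum_squares_bound[of "norm (\<psi> n x)" "norm (\<psi> n y)"]
    mult_nonneg_nonneg[OF norm_ge_zero[of "\<psi> n x"] norm_ge_zero[of "\<psi> n y"]]
  unfolding norm_mult norm_conjg by linarith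

lemma summable_norm_series:
  "x \<in> X \<Longrightarrow> y \<in> X \<Longrightarrow> summable (\<lambda>n. norm (\<psi> n x * conjg (\<psi> n y)))"
  by (rule summable_comparison_test'[OF summable_add[OF summable_\<psi>[of x] summable_\<psi>[of y]], of 0])
     (use norm_\<psi>_mult_le in auto)

definition mercer_sum :: "'a \<Rightarrow> 'a \<Rightarrow> 'k" where
  "mercer_sum x y = (\<Sum>n. \<psi> n x * conjg (\<psi> n y))"

lemma mercer_sum_sums: "x \<in> X \<Longrightarrow> y \<in> X \<Longrightarrow> (\<lambda>n. \<psi> n x * conjg (\<psi> n y)) sums mercer_sum x y"
  unfolding mercer_sum_def by (intro summable_sums summable_norm_cancel[OF summable_norm_series])

text \<open>With \<open>x\<close> fixed, the tail in the first variable is that of one convergent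
  series, so convergence is uniform in \<open>y\<close>. This precedes any knowledge of the sum and
  thus avoids circularity.\<close>

lemma continuous_mercer_sum_section:
  assumes x: "x \<in> X"
  shows "continuous_on X (mercer_sum x)"
proof -
  obtain C where C: "\<And>x y. x \<in> X \<Longrightarrow> y \<in> X \<Longrightarrow> norm (K x y) \<le> C" using K_bounded by metis
  have "uniform_limit ({x} \<times> X) (\<lambda>m (x, y). \<Sum>n<m. \<psi> n x * conjg (\<psi> n y)) (\<lambda>(x, y). mercer_sum x y) sequentially"
  proof (rule uniform_limit_conjg_series)
    fix e :: real assume "e > 0"
    then have "\<exists>M. \<forall>m\<ge>M. \<forall>k. norm (\<Sum>n\<in>{m..<k}. (norm (\<psi> n x))\<^sup>2) < e"
      using summable_\<psi>[OF x] unfolding summable_Cauchy by blast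
    then show "\<exists>M. \<forall>m\<ge>M. \<forall>k. \<forall>(x, y)\<in>{x} \<times> X. (\<Sum>n\<in>{m..<k}. (norm (\<psi> n x))\<^sup>2) < e"
      by (auto simp: sum_nonneg)
  qed (use x mercer_sum_sums \<psi>_Bessel C order_trans in blast)+
  then have "uniform_limit X (\<lambda>m y. \<Sum>n<m. \<psi> n x * conjg (\<psi> n y)) (mercer_sum x) sequentially"
    by (auto simp: uniform_limit_iff)
  then show ?thesis
    by (rule uniform_limit_theorem[rotated])
       (auto intro!: always_eventually continuous_intros continuous_on_conjg continuous_\<psi>)
qed

text \<open>
  The difference \<open>h = K x - mercer_sum x\<close> is orthogonal to all eigenfunctions after conjugation, so \<open>T\<close>
  kills its conjugate; evaluating at \<open>x\<close> gives \<open>\<integral> \<bar>h\<bar>\<^sup>2 = 0\<close>.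
\<close>

lemma K_eq_mercer_sum:
  assumes x: "x \<in> X" and y: "y \<in> X"
  shows "K x y = mercer_sum x y"
proof (cases "y \<in> kernel_supp X K")
  \<comment> \<open>The split concerns \<open>y\<close>, the point where \<open>h\<close> is to
    vanish: off \<open>kernel_supp\<close> both sides are zero, since every \<open>\<psi> n\<close>
    is.\<close>
  case False
  then have "mercer_sum x y = 0" using \<psi>_outside[OF y] by (simp add: mercer_sum_def)
  moreover have "K x y = 0" using False x y by (auto simp: kernel_supp_def)
  ultimately show ?thesis by simp
next
  case True
  obtain C where C: "\<And>x y. x \<in> X \<Longrightarrow> y \<in> X \<Longrightarrow> norm (K x y) \<le> C" using K_bounded by metis
  define h where "h t = K x t - mercer_sum x t" for t
  have h_cont: "continuous_on X h"
    unfolding h_def by (intro continuous_on_diff continuous_K_section continuous_mercer_sum_section x)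
  have h_L2: "h \<in> L2_fun \<nu>" by (rule L2_fun_continuous[OF h_cont])
  \<comment> \<open>Termwise integration; the partial sums are dominated by \<open>C + C\<close>
    through Bessel's inequality at \<open>x\<close> and at \<open>t\<close>.\<close>
  have series: "(\<lambda>m. \<Sum>n<m. \<psi> n x * L2_inner \<nu> w (\<psi> n)) \<longlonglongrightarrow> (\<integral>t. mercer_sum x t * w t \<partial>\<nu>)"
    if w: "w \<in> L2_fun \<nu>" for w
  proof -
    have "(\<lambda>m. \<integral>t. (\<Sum>n<m. \<psi> n x * conjg (\<psi> n t)) * w t \<partial>\<nu>) \<longlonglongrightarrow> (\<integral>t. mercer_sum x t * w t \<partial>\<nu>)"
    proof (rule bounded_convergence[OF L2_fun_integrable[OF w]])
      show "(\<lambda>t. \<Sum>n<m. \<psi> n x * conjg (\<psi> n t)) \<in> borel_measurable \<nu>" for m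
        by (intro measurable_continuous continuous_intros continuous_on_conjg continuous_\<psi>)
      show "mercer_sum x \<in> borel_measurable \<nu>" by (rule measurable_continuous[OF continuous_mercer_sum_section[OF x]])
      show "norm (\<Sum>n<m. \<psi> n x * conjg (\<psi> n t)) \<le> C + C" if t: "t \<in> X" for m t
      proof -
        have "norm (\<Sum>n<m. \<psi> n x * conjg (\<psi> n t)) \<le> (\<Sum>n<m. (norm (\<psi> n x))\<^sup>2 + (norm (\<psi> n t))\<^sup>2)"
          by (intro order_trans[OF norm_sum] sum_mono norm_\<psi>_mult_le)
        also have "\<dots> \<le> C + C"
          unfolding sum.distrib using x t by (intro add_mono order_trans[OF \<psi>_Bessel C])
        finally show ?thesis .
      qed
      show "(\<lambda>m. \<Sum>n<m. \<psi> n x * conjg (\<psi> n t)) \<longlonglongrightarrow> mercer_sum x t" if "t \<in> X" for t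
        using mercer_sum_sums[OF x that] by (simp add: sums_def)
    qed
    moreover have "(\<integral>t. (\<Sum>n<m. \<psi> n x * conjg (\<psi> n t)) * w t \<partial>\<nu>) = (\<Sum>n<m. \<psi> n x * L2_inner \<nu> w (\<psi> n))"
      for m
    proof -
      have "(\<Sum>n<m. \<psi> n x * conjg (\<psi> n t)) * w t = (\<Sum>n<m. \<psi> n x * (w t * conjg (\<psi> n t)))" for t
        by (simp add: sum_distrib_left mult_ac)
      then show ?thesis
        using L2_fun_integrable_mult[OF w L2_fun_conjg[OF \<psi>_L2]] by (simp add: L2_inner_def)
    qed
    ultimately show ?thesis by simp
  qed
  have K_int: "integrable \<nu> (\<lambda>t. K x t * w t)" and mercer_sum_int: "integrable \<nu> (\<lambda>t. mercer_sum x t * w t)"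
    if "w \<in> L2_fun \<nu>" for w
    using L2_fun_integrable_mult[OF L2_fun_continuous that] continuous_K_section[OF x]
      continuous_mercer_sum_section[OF x] by auto
  have split: "(\<integral>t. h t * w t \<partial>\<nu>) = T w x - (\<integral>t. mercer_sum x t * w t \<partial>\<nu>)" if "w \<in> L2_fun \<nu>" for w
    using K_int[OF that] mercer_sum_int[OF that] by (simp add: h_def left_diff_distrib integral_op_def)
  \<comment> \<open>By orthonormality only the term \<open>n = i\<close> survives, and its value
    \<open>of_real (ev i) * \<phi> i x\<close> is exactly \<open>T (\<phi> i) x\<close>.\<close>
  have h_\<phi>: "(\<integral>t. h t * \<phi> i t \<partial>\<nu>) = 0" if i: "enat i < N" for i
  proof -
    have "\<psi> n x * L2_inner \<nu> (\<phi> i) (\<psi> n) = (if n = i then of_real (ev i) * \<phi> i x else 0)" for n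
    proof (cases "enat n < N")
      case True
      have "L2_inner \<nu> (\<phi> i) (\<psi> n) = of_real (sqrt (ev n)) * (if i = n then 1 else 0)"
        using True i L2_inner_cmult_right[of \<nu> "\<phi> i" "of_real (sqrt (ev n))" "\<phi> n"]
        by (simp add: \<psi>_def[abs_def] \<phi>_inner conjg_of_real)
      moreover have sq: "of_real (sqrt (ev i)) * of_real (sqrt (ev i)) = (of_real (ev i) :: 'k)"
        using ev_pos[OF i] by (simp flip: of_real_mult)
      ultimately show ?thesis using True unfolding sq[symmetric] by (simp add: \<psi>_def mult_ac)
    qed (use i in \<open>auto simp: \<psi>_def\<close>)
    then have "(\<lambda>m. \<Sum>n<m. if n = i then of_real (ev i) * \<phi> i x else 0) \<longlonglongrightarrow> (\<integral>t. mercer_sum x t * \<phi> i t \<partial>\<nu>)"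
      using series[OF \<phi>_L2[OF i]] by simp
    moreover have "(\<lambda>m. \<Sum>n<m. if n = i then of_real (ev i) * \<phi> i x else 0) \<longlonglongrightarrow> of_real (ev i) * \<phi> i x"
      using sums_single[of i "\<lambda>_. of_real (ev i) * \<phi> i x"] by (simp add: sums_def)
    ultimately have "(\<integral>t. mercer_sum x t * \<phi> i t \<partial>\<nu>) = of_real (ev i) * \<phi> i x"
      using LIMSEQ_unique by blast
    then show ?thesis using split[OF \<phi>_L2[OF i]] T_\<phi>[OF i x] by simp
  qed
  \<comment> \<open>\<open>T\<close> integrates against a row of \<open>K\<close> without
    conjugation, whereas \<open>L2_inner\<close> conjugates its second argument; so the bilinear
    relation \<open>h_\<phi>\<close> expresses orthogonality of \<open>g\<close>, not of
    \<open>h\<close>.\<close>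
  define g where "g t = conjg (h t)" for t
  have g_L2: "g \<in> L2_fun \<nu>" unfolding g_def by (rule L2_fun_conjg[OF h_L2])
  have g_\<phi>: "L2_inner \<nu> g (\<phi> n) = 0" if "enat n < N" for n
  proof -
    have "L2_inner \<nu> g (\<phi> n) = conjg (\<integral>t. h t * \<phi> n t \<partial>\<nu>)"
      by (simp add: L2_inner_def g_def flip: integral_conjg)
    then show ?thesis using h_\<phi>[OF that] by simp
  qed
  then have "T g x = 0" using g_L2 by (intro T_zero_orthocomp x) (simp add: orthocomp_def)
  moreover have "(\<integral>t. mercer_sum x t * g t \<partial>\<nu>) = 0"
  proof -
    have "L2_inner \<nu> g (\<psi> n) = 0" for n
      using g_\<phi> L2_inner_cmult_right[of \<nu> g "of_real (sqrt (ev n))" "\<phi> n"]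
      by (cases "enat n < N") (auto simp: \<psi>_def[abs_def] L2_inner_def)
    then have "(\<lambda>m::nat. 0) \<longlonglongrightarrow> (\<integral>t. mercer_sum x t * g t \<partial>\<nu>)" using series[OF g_L2] by simp
    then show ?thesis by (simp add: LIMSEQ_const_iff)
  qed
  ultimately have "(\<integral>t. h t * g t \<partial>\<nu>) = 0" using split[OF g_L2] by simp
  then have "L2_inner \<nu> h h = 0" by (simp add: L2_inner_def g_def)
  then have "AE t in \<nu>. h t = 0" using L2_norm_sq_eq_0_iff[OF h_L2] by (simp add: L2_inner_self)
  then have "h y = 0" using zero_on_measure_supp[OF h_cont] True supp by blast
  then show ?thesis by (simp add: h_def)
qed

lemma uniform_limit_series:
  "uniform_limit (X \<times> X) (\<lambda>m (x, y). \<Sum>n<m. \<psi> n x * conjg (\<psi> n y)) (\<lambda>(x, y). K x y) sequentially"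
proof -
  obtain C where C: "\<And>x y. x \<in> X \<Longrightarrow> y \<in> X \<Longrightarrow> norm (K x y) \<le> C" using K_bounded by metis
  show ?thesis
  proof (rule uniform_limit_conjg_series)
    show "(\<Sum>n<m. (norm (\<psi> n y))\<^sup>2) \<le> C" if "(x, y) \<in> X \<times> X" for x y m
      using \<psi>_Bessel[of y m] C[of y y] that by auto
    show "(\<lambda>n. \<psi> n x * conjg (\<psi> n y)) sums K x y" if "(x, y) \<in> X \<times> X" for x y
      using that mercer_sum_sums K_eq_mercer_sum by auto
    fix e :: real assume "e > 0"
    \<comment> \<open>The diagonal remainder: continuous, decreasing in \<open>m\<close> because the
      summands are nonnegative, and tending to zero by the identity already proved.\<close>
    define d where "d m x = norm (K x x) - (\<Sum>n<m. (norm (\<psi> n x))\<^sup>2)" for m x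
    have "\<exists>M. \<forall>m\<ge>M. \<forall>x\<in>X. d m x < e"
    proof (rule Dini_decreasing[OF compact_X _ _ _ \<open>e > 0\<close>])
      have "continuous_on X (\<lambda>x. K x x)"
        using continuous_on_compose2[OF continuous_K, of X "\<lambda>x. (x, x)"]
        by (fastforce intro: continuous_on_Pair continuous_on_id)
      then show "continuous_on X (d m)" for m
        unfolding d_def by (intro continuous_intros continuous_\<psi>)
      show "d n x \<le> d m x" if "m \<le> n" for m n x
        unfolding d_def using that by (intro diff_left_mono sum_mono2) auto
      show "(\<lambda>m. d m x) \<longlonglongrightarrow> 0" if x: "x \<in> X" for x
      proof -
        have "(\<lambda>n. of_real ((norm (\<psi> n x))\<^sup>2)) sums (of_real (norm (K x x)) :: 'k)"
          using mercer_sum_sums[OF x x] K_eq_mercer_sum[OF x x] K_diag[OF x] by (simp only: mult_conjg)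
        then have "(\<lambda>n. (norm (\<psi> n x))\<^sup>2) sums norm (K x x)" by (simp only: sums_of_real_iff)
        then have "(\<lambda>m. d m x) \<longlonglongrightarrow> norm (K x x) - norm (K x x)"
          unfolding d_def sums_def by (intro tendsto_diff tendsto_const)
        then show ?thesis by simp
      qed
    qed
    then obtain M where M: "\<And>m x. m \<ge> M \<Longrightarrow> x \<in> X \<Longrightarrow> d m x < e" by blast
    have "(\<Sum>n\<in>{m..<k}. (norm (\<psi> n x))\<^sup>2) < e" if "m \<ge> M" "x \<in> X" for m k x
    proof (cases "m \<le> k")
      case True
      have "(\<Sum>n\<in>{m..<k}. (norm (\<psi> n x))\<^sup>2) = (\<Sum>n<k. (norm (\<psi> n x))\<^sup>2) - (\<Sum>n<m. (norm (\<psi> n x))\<^sup>2)"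
        using sum_diff_nat_ivl[of 0 m k "\<lambda>n. (norm (\<psi> n x))\<^sup>2"] True by (simp add: atLeast0LessThan)
      \<comment> \<open>Bessel's inequality bounds the partial sum up to \<open>k\<close> by the
        diagonal value, so \<open>d m x\<close> controls the block for all \<open>k\<close> at
        once.\<close>
      also have "\<dots> \<le> d m x" using \<psi>_Bessel[OF that(2), of k] by (simp add: d_def)
      finally show ?thesis using M[OF that] by simp
    qed (use \<open>e > 0\<close> in simp)
    then show "\<exists>M. \<forall>m\<ge>M. \<forall>k. \<forall>(x, y)\<in>X \<times> X. (\<Sum>n\<in>{m..<k}. (norm (\<psi> n x))\<^sup>2) < e" by blast
  qed
qed

end

theorem theorem4p16:
  fixes X :: "'a::metric_space set"
    and K :: "'a \<Rightarrow> 'a \<Rightarrow> 'k::real_or_complex"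
    and \<nu> :: "'a measure"
    and N :: enat
    and ev :: "nat \<Rightarrow> real"
    and \<phi> :: "nat \<Rightarrow> 'a \<Rightarrow> 'k"
  assumes "compact X"
    and "mercer_kernel X K"
    and "sets \<nu> = sets (restrict_space borel X)"
    and "finite_measure \<nu>"
    and "kernel_supp X K \<subseteq> measure_supp X \<nu>"
    and "enumerates_nonzero_eigenvalues \<nu> K N ev"
    and "orthonormal_system \<nu> {n. enat n < N} \<phi>"
    and "\<And>n. enat n < N \<Longrightarrow> \<phi> n \<in> eigenspace \<nu> K (of_real (ev n))"
    and "\<And>n x. enat n < N \<Longrightarrow> x \<in> X \<Longrightarrow>
           \<phi> n x = 1 / of_real (ev n) * integral_op \<nu> K (\<phi> n) x"
  shows "(\<forall>x\<in>X. \<forall>y\<in>X. (\<lambda>n. mercer_term N ev \<phi> n x y) sums K x y)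
       \<and> (\<forall>x\<in>X. \<forall>y\<in>X. summable (\<lambda>n. norm (mercer_term N ev \<phi> n x y)))
       \<and> uniform_limit (X \<times> X) (\<lambda>m (x, y). \<Sum>n<m. mercer_term N ev \<phi> n x y)
            (\<lambda>(x, y). K x y) sequentially"
proof -
  interpret finite_measure \<nu> by fact
  interpret mercer_system X K \<nu> N ev \<phi>
    by unfold_locales (fact assms)+
  show ?thesis
    unfolding mercer_term_eq using mercer_sum_sums K_eq_mercer_sum summable_norm_series uniform_limit_series by simp
qed

end
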